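(* Let $f\in\mathcal F_{\mathrm{op}}$ and let $n\ge 1$. Then the quantum $\chi^2$-divergence $\chi^2_f(\rho,\sigma)$ is jointly convex in $(\rho,\sigma)$ on pairs of positive definite $n\times n$ density matrices. That is, for all positive definite density matrices $\rho_1,\rho_2,\sigma_1,\sigma_2\in M_n(\mathbb C)$ and all $\lambda\in[0,1]$, \[ \chi^2_f\bigl(\lambda\rho_1+(1-\lambda)\rho_2,\ \lambda\sigma_1+(1-\lambda)\sigma_2\bigr)\le \lambda\,\chi^2_f(\rho_1,\sigma_1)+(1-\lambda)\,\chi^2_f(\rho_2,\sigma_2). \]
   Context: $\mathcal F_{\mathrm{op}}$ denotes the class of functions $f:(0,\infty)\to(0,\infty)$ such that (i) $f$ is operator monotone, (ii) $f(t)=t\,f(t^{-1})$ for all $t>0$, and (iii) $f(1)=1$. $M_n(\mathbb C)$ is regarded as a Hilbert space with the inner product $(A\mid B)=\mathrm{Tr}\,A^*B$. A density matrix is a positive semidefinite matrix of trace one. For a positive definite $\sigma\in M_n(\mathbb C)$, the (super)operators $L_\sigma,R_\sigma$ on $M_n(\mathbb C)$ are defined by $L_\sigma A=\sigma A$ and $R_\sigma A=A\sigma$; they are commuting positive definite operators on $M_n(\mathbb C)$, so functions of the pair $(L_\sigma,R_\sigma)$ are defined by joint functional calculus. For $f\in\mathcal F_{\mathrm{op}}$, the Morozova–Chentsov function is $c(x,y)=\dfrac{1}{y\,f(x y^{-1})}$ for $x,y>0$, and the associated monotone metric is $K_\sigma(A,B)=\mathrm{Tr}\,A^*\,c(L_\sigma,R_\sigma)(B)$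 for positive definite $\sigma$ and $A,B\in M_n(\mathbb C)$. The $\chi^2_f$-divergence of density matrices $\rho,\sigma$ with $\sigma$ positive definite is \[ \chi^2_f(\rho,\sigma)=K_\sigma(\rho-\sigma,\rho-\sigma)=\mathrm{Tr}\,(\rho-\sigma)\,c(L_\sigma,R_\sigma)(\rho-\sigma). \] *)

theory Defs
  imports Complex_Main "Jordan_Normal_Form.Schur_Decomposition"
begin

definition mtrace :: "complex mat \<Rightarrow> complex" where
  "mtrace A = (\<Sum>i<dim_row A. A $$ (i,i))"

definition hermitian :: "nat \<Rightarrow> complex mat \<Rightarrow> bool" where
  "hermitian n A \<longleftrightarrow> A \<in> carrier_mat n n \<and> mat_adjoint A = A"

definition qform :: "nat \<Rightarrow> complex mat \<Rightarrow> complex vec \<Rightarrow> complex" where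
  "qform n A v = (\<Sum>i<n. \<Sum>j<n. cnj (v $ i) * A $$ (i,j) * v $ j)"

definition psd :: "nat \<Rightarrow> complex mat \<Rightarrow> bool" where
  "psd n A \<longleftrightarrow> hermitian n A \<and> (\<forall>v \<in> carrier_vec n. 0 \<le> Re (qform n A v))"

definition pd :: "nat \<Rightarrow> complex mat \<Rightarrow> bool" where
  "pd n A \<longleftrightarrow> hermitian n A \<and> (\<forall>v \<in> carrier_vec n. v \<noteq> 0\<^sub>v n \<longrightarrow> 0 < Re (qform n A v))"

definition density :: "nat \<Rightarrow> complex mat \<Rightarrow> bool" where
  "density n \<rho> \<longleftrightarrow> psd n \<rho> \<and> mtrace \<rho> = 1"

definition unitary :: "nat \<Rightarrow> complex mat \<Rightarrow> bool" where
  "unitary n U \<longleftrightarrow> U \<in> carrier_mat n n \<and> mat_adjoint U * U = 1\<^sub>m n"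

definition rdiag :: "nat \<Rightarrow> (nat \<Rightarrow> real) \<Rightarrow> complex mat" where
  "rdiag n l = mat n n (\<lambda>(i,j). if i = j then complex_of_real (l i) else 0)"

definition spec_decomp :: "nat \<Rightarrow> complex mat \<Rightarrow> complex mat \<Rightarrow> (nat \<Rightarrow> real) \<Rightarrow> bool" where
  "spec_decomp n A U l \<longleftrightarrow> unitary n U \<and> A = U * rdiag n l * mat_adjoint U"

text \<open>functional calculus f(A) for a Hermitian matrix A (independent of the decomposition)\<close>
definition mfun :: "(real \<Rightarrow> real) \<Rightarrow> complex mat \<Rightarrow> complex mat" where
  "mfun f A = (let n = dim_row A in
     SOME B. \<exists>U l. spec_decomp n A U l \<and> B = U * rdiag n (f \<circ> l) * mat_adjoint U)"

definition operator_monotone :: "(real \<Rightarrow> real) \<Rightarrow> bool" where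
  "operator_monotone f \<longleftrightarrow>
     (\<forall>n A B. pd n A \<and> pd n B \<and> psd n (B - A) \<longrightarrow> psd n (mfun f B - mfun f A))"

definition Fop :: "(real \<Rightarrow> real) \<Rightarrow> bool" where
  "Fop f \<longleftrightarrow> (\<forall>t>0. f t > 0) \<and> operator_monotone f
     \<and> (\<forall>t>0. f t = t * f (inverse t)) \<and> f 1 = 1"

definition MC :: "(real \<Rightarrow> real) \<Rightarrow> real \<Rightarrow> real \<Rightarrow> real" where
  "MC f x y = 1 / (y * f (x / y))"

text \<open>joint functional calculus c(L_sigma, R_sigma) applied to X: if
  sigma = sum_i l_i P_i then c(L,R) X = sum_{i,j} c(l_i,l_j) P_i X P_j; in an eigenbasis
  sigma = U diag(l) U^* this is U [c(l_i,l_j) (U^* X U)_ij] U^*\<close>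
definition jointfun :: "(real \<Rightarrow> real \<Rightarrow> real) \<Rightarrow> complex mat \<Rightarrow> complex mat \<Rightarrow> complex mat" where
  "jointfun c \<sigma> X = (let n = dim_row \<sigma> in
     SOME Y. \<exists>U l. spec_decomp n \<sigma> U l \<and>
       Y = U * mat n n (\<lambda>(i,j). complex_of_real (c (l i) (l j)) * (mat_adjoint U * X * U) $$ (i,j))
           * mat_adjoint U)"

definition Kmetric :: "(real \<Rightarrow> real) \<Rightarrow> complex mat \<Rightarrow> complex mat \<Rightarrow> complex mat \<Rightarrow> complex" where
  "Kmetric f \<sigma> A B = mtrace (mat_adjoint A * jointfun (MC f) \<sigma> B)"

definition chi2 :: "(real \<Rightarrow> real) \<Rightarrow> complex mat \<Rightarrow> complex mat \<Rightarrow> complex" where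
  "chi2 f \<rho> \<sigma> = Kmetric f \<sigma> (\<rho> - \<sigma>) (\<rho> - \<sigma>)"

end

(*
  Write M(\<sigma>) for the superoperator m(L_\<sigma>, R_\<sigma>) with m(x,y) = y f(x/y), so that
  chi^2_f(\<rho>,\<sigma>) = <X, M(\<sigma>)^{-1} X> with X = \<rho> - \<sigma>.  By the variational formula
  <X, M^{-1} X> = sup_Y (2 Re <X,Y> - <Y, M Y>), joint convexity reduces to concavity of
  \<sigma> \<mapsto> <Y, M(\<sigma>) Y> for fixed Y.

  Concavity is an operator Jensen inequality C^* f(T) C \<le> f(C^* T C) for an isometry C, applied to
  the direct sum T of the operators L_{\<sigma>_k} R_{\<sigma>_k}^{-1} and
  C = (sqrt(w_k) R_{\<sigma>_k}^{1/2} R_\<sigma>^{-1/2})_k, where \<sigma> = \<Sum>_k w_k \<sigma>_k.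
  As in Hansen and Pedersen, C is dilated to a unitary W; the off-diagonal blocks of
  W^* (T \<oplus> 1) W are absorbed by a factor 1 + \<delta> on the first diagonal block and a large multiple
  of the identity on the second, and operator monotonicity is applied to this comparison.
  The symmetry f(t) = t f(1/t) makes f(t)/t decreasing, whence f((1+\<delta>)t) \<le> (1+\<delta>) f(t), so
  \<delta> can be sent to 0 without a separate proof that f is continuous.
*)
theory Submission
  imports Defs "Jordan_Normal_Form.Spectral_Radius"
begin

subsection \<open>The spectral theorem\<close>

lemma mat_adjoint_eq: "mat_adjoint A = mat (dim_col A) (dim_row A) (\<lambda>(i,j). cnj (A $$ (j,i)))"
  by (rule eq_matI) (auto simp: mat_adjoint_def mat_of_rows_def)

lemma dim_mat_adjoint [simp]:
  "dim_row (mat_adjoint (A :: complex mat)) = dim_col A"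
  "dim_col (mat_adjoint (A :: complex mat)) = dim_row A"
  by (auto simp: mat_adjoint_eq)

lemma mat_adjoint_carrier [simp]:
  "A \<in> carrier_mat n m \<Longrightarrow> mat_adjoint (A :: complex mat) \<in> carrier_mat m n"
  by (auto simp: mat_adjoint_eq)

lemma mat_adjoint_index [simp]:
  "i < dim_col A \<Longrightarrow> j < dim_row A \<Longrightarrow> mat_adjoint A $$ (i,j) = cnj (A $$ (j,i))"
  by (auto simp: mat_adjoint_eq)

lemma mat_adjoint_adjoint [simp]: "mat_adjoint (mat_adjoint A) = (A :: complex mat)"
  by (rule eq_matI) auto

lemma mat_mult_index_sum:
  "A \<in> carrier_mat n m \<Longrightarrow> B \<in> carrier_mat m k \<Longrightarrow> i < n \<Longrightarrow> j < k \<Longrightarrow>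
    (A * B) $$ (i,j) = (\<Sum>r<m. A $$ (i,r) * B $$ (r,j))"
  by (auto simp: scalar_prod_def atLeast0LessThan intro!: sum.cong)

lemma mat_adjoint_mult:
  fixes A B :: "complex mat"
  assumes "A \<in> carrier_mat n m" "B \<in> carrier_mat m k"
  shows "mat_adjoint (A * B) = mat_adjoint B * mat_adjoint A"
proof (rule eq_matI)
  fix i j assume "i < dim_row (mat_adjoint B * mat_adjoint A)" "j < dim_col (mat_adjoint B * mat_adjoint A)"
  with assms have ij: "i < k" "j < n" by auto
  have "(A * B) $$ (j,i) = (\<Sum>r<m. A $$ (j,r) * B $$ (r,i))"
    by (rule mat_mult_index_sum[OF assms ij(2,1)])
  moreover have "(mat_adjoint B * mat_adjoint A) $$ (i,j)
      = (\<Sum>r<m. mat_adjoint B $$ (i,r) * mat_adjoint A $$ (r,j))"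
    by (rule mat_mult_index_sum[OF _ _ ij]) (use assms in auto)
  ultimately show "mat_adjoint (A * B) $$ (i,j) = (mat_adjoint B * mat_adjoint A) $$ (i,j)"
    using assms ij by (auto simp: mult.commute intro!: sum.cong)
qed (use assms in auto)

lemma unitary_carrier: "unitary n U \<Longrightarrow> U \<in> carrier_mat n n"
  by (auto simp: unitary_def)

lemma unitary_adjoint_mult: "unitary n U \<Longrightarrow> mat_adjoint U * U = 1\<^sub>m n"
  by (auto simp: unitary_def)

text \<open>\<open>unitary\<close> records only that U^* is a left inverse; for square matrices a
  left inverse is also a right inverse.\<close>

lemma unitary_mult_adjoint:
  assumes "unitary n U"
  shows "U * mat_adjoint U = 1\<^sub>m n"
  using mat_mult_left_right_inverse[of "mat_adjoint U" n U] assms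
  by (auto simp: unitary_def)

lemma unitary_adjoint: "unitary n U \<Longrightarrow> unitary n (mat_adjoint U)"
  using unitary_mult_adjoint[of n U] by (auto simp: unitary_def)

text \<open>The brackets nest to the right to match the normal form that
  \<open>assoc_mult_mat\<close> produces, so adjacent factors U and U^* cancel by rewriting inside
  longer products.\<close>

lemma unitary_mult_cancel:
  assumes "unitary n U" "X \<in> carrier_mat n n"
  shows "U * (mat_adjoint U * X) = X" "mat_adjoint U * (U * X) = X"
proof -
  have U: "U \<in> carrier_mat n n" using assms by (simp add: unitary_carrier)
  have "U * mat_adjoint U * X = X"
    using unitary_mult_adjoint[OF assms(1)] assms(2) by simp
  then show "U * (mat_adjoint U * X) = X"
    using U assms(2) by (simp add: assoc_mult_mat[of _ n n _ n _ n])
  have "mat_adjoint U * U * X = X"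
    using unitary_adjoint_mult[OF assms(1)] assms(2) by simp
  then show "mat_adjoint U * (U * X) = X"
    using U assms(2) by (simp add: assoc_mult_mat[of _ n n _ n _ n])
qed

lemma unitary_mult:
  assumes "unitary n U" "unitary n V"
  shows "unitary n (U * V)"
proof -
  have U: "U \<in> carrier_mat n n" "V \<in> carrier_mat n n" using assms by (auto simp: unitary_carrier)
  have "mat_adjoint (U * V) * (U * V) = mat_adjoint V * (mat_adjoint U * (U * V))"
    using U by (simp add: mat_adjoint_mult[of _ n n _ n] assoc_mult_mat[of _ n n _ n _ n])
  also have "\<dots> = 1\<^sub>m n"
    using unitary_mult_cancel(2)[OF assms(1) U(2)] unitary_adjoint_mult[OF assms(2)] by simp
  finally show ?thesis using U by (auto simp: unitary_def)
qed

lemma rdiag_carrier [simp]: "rdiag n l \<in> carrier_mat n n"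
  by (simp add: rdiag_def)

lemma rdiag_dim [simp]: "dim_row (rdiag n l) = n" "dim_col (rdiag n l) = n"
  by (simp_all add: rdiag_def)

lemma rdiag_mult_index:
  assumes "A \<in> carrier_mat n n" "i < n" "j < n"
  shows "(rdiag n l * A) $$ (i,j) = complex_of_real (l i) * A $$ (i,j)"
    and "(A * rdiag n l) $$ (i,j) = A $$ (i,j) * complex_of_real (l j)"
proof -
  have "(rdiag n l * A) $$ (i,j) = (\<Sum>r<n. rdiag n l $$ (i,r) * A $$ (r,j))"
    by (rule mat_mult_index_sum) (use assms in auto)
  also have "\<dots> = (\<Sum>r<n. if i = r then complex_of_real (l i) * A $$ (i,j) else 0)"
    using assms by (intro sum.cong) (auto simp: rdiag_def)
  finally show "(rdiag n l * A) $$ (i,j) = complex_of_real (l i) * A $$ (i,j)"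
    using assms by simp
  have "(A * rdiag n l) $$ (i,j) = (\<Sum>r<n. A $$ (i,r) * rdiag n l $$ (r,j))"
    by (rule mat_mult_index_sum) (use assms in auto)
  also have "\<dots> = (\<Sum>r<n. if r = j then A $$ (i,j) * complex_of_real (l j) else 0)"
    using assms by (intro sum.cong) (auto simp: rdiag_def)
  finally show "(A * rdiag n l) $$ (i,j) = A $$ (i,j) * complex_of_real (l j)"
    using assms by simp
qed

section \<open>Diagonalisation of Hermitian matrices by deflation\<close>

lemma unitary_with_first_column:
  fixes v :: "complex vec"
  assumes v: "v \<in> carrier_vec n" "v \<noteq> 0\<^sub>v n" and n: "n \<noteq> 0"
  shows "\<exists>U c. unitary n U \<and> col U 0 = c \<cdot>\<^sub>v v"
proof -
  \<comment> \<open>Completing \<open>v\<close> to a basis and orthogonalising keeps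
    \<open>v\<close> as the first vector, since Gram-Schmidt does not alter the head of its list.
    The output is orthogonal but not normalised, hence the factors \<open>d i\<close> below.\<close>
  define b where "b = basis_completion v"
  define ws where "ws = gram_schmidt n b"
  interpret cof_vec_space n "TYPE(complex)" .
  from basis_completion[OF v, folded b_def]
  have dist_b: "distinct b" and indep: "\<not> lin_dep (set b)" and b: "set b \<subseteq> carrier_vec n"
    and hdb: "hd b = v" and len_b: "length b = n" by auto
  from hdb len_b n obtain vs where bv: "b = v # vs" by (cases b) auto
  from gram_schmidt_result[OF b dist_b indep refl, folded ws_def]
  have ws: "set ws \<subseteq> carrier_vec n" "corthogonal ws" "length ws = n"
    by (auto simp: len_b)
  from gram_schmidt_hd[OF v(1), of vs, folded bv] have hdws: "hd ws = v" unfolding ws_def .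
  have ws_carrier: "ws ! i \<in> carrier_vec n" if "i < n" for i
    using ws that by auto
  define s where "s i = (\<Sum>r<n. (cmod (ws ! i $ r))\<^sup>2)" for i
  define d where "d i = complex_of_real (1 / sqrt (s i))" for i
  define U where "U = mat n n (\<lambda>(r,i). d i * ws ! i $ r)"
  have inner: "ws ! j \<bullet>c ws ! i = (\<Sum>r<n. cnj (ws ! i $ r) * ws ! j $ r)" if "i < n" "j < n" for i j
    using ws_carrier[OF that(1)] ws_carrier[OF that(2)]
    by (auto simp: scalar_prod_def atLeast0LessThan mult.commute intro!: sum.cong)
  have self: "ws ! i \<bullet>c ws ! i = complex_of_real (s i)" if "i < n" for i
    unfolding inner[OF that that] s_def of_real_sum
    by (intro sum.cong) (auto simp: complex_norm_square[symmetric] mult.commute)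
  have s_pos: "s i > 0" if "i < n" for i
  proof -
    \<comment> \<open>\<open>corthogonal\<close> says that the inner product of two members vanishes
      exactly for distinct positions, so no vector in \<open>ws\<close> is zero.\<close>
    have "ws ! i \<bullet>c ws ! i \<noteq> 0" using ws that unfolding corthogonal_def by auto
    then have "s i \<noteq> 0" using self[OF that] by auto
    moreover have "s i \<ge> 0" by (auto simp: s_def intro!: sum_nonneg)
    ultimately show ?thesis by simp
  qed
  have U: "U \<in> carrier_mat n n" by (simp add: U_def)
  have "mat_adjoint U * U = 1\<^sub>m n"
  proof (rule eq_matI)
    fix i j assume "i < dim_row (1\<^sub>m n)" "j < dim_col (1\<^sub>m n)"
    then have ij: "i < n" "j < n" by auto
    have "(mat_adjoint U * U) $$ (i,j) = (\<Sum>r<n. mat_adjoint U $$ (i,r) * U $$ (r,j))"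
      by (rule mat_mult_index_sum) (use U ij in auto)
    also have "\<dots> = (\<Sum>r<n. d i * d j * (cnj (ws ! i $ r) * ws ! j $ r))"
      using ij by (intro sum.cong) (auto simp: U_def d_def)
    also have "\<dots> = d i * d j * (ws ! j \<bullet>c ws ! i)"
      using inner[OF ij] by (simp add: sum_distrib_left)
    also have "\<dots> = 1\<^sub>m n $$ (i,j)"
    proof (cases "i = j")
      case True
      have "d i * d i * complex_of_real (s i) = complex_of_real (1 / sqrt (s i) * (1 / sqrt (s i)) * s i)"
        by (simp only: d_def of_real_mult)
      also have "1 / sqrt (s i) * (1 / sqrt (s i)) * s i = 1"
        using s_pos[OF ij(1)] by (simp add: field_simps)
      finally show ?thesis using True ij self by simp
    next
      case False
      then have "ws ! j \<bullet>c ws ! i = 0" using ws ij unfolding corthogonal_def by auto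
      then show ?thesis using False ij by simp
    qed
    finally show "(mat_adjoint U * U) $$ (i,j) = 1\<^sub>m n $$ (i,j)" .
  qed (use U in auto)
  moreover have "col U 0 = d 0 \<cdot>\<^sub>v v"
    using n hdws ws ws_carrier[of 0] by (intro eq_vecI) (auto simp: U_def hd_conv_nth)
  ultimately show ?thesis using U unfolding unitary_def by blast
qed

lemma hermitian_conj:
  assumes "hermitian n A" "W \<in> carrier_mat n n"
  shows "hermitian n (mat_adjoint W * A * W)"
  using assms unfolding hermitian_def
  by (simp add: mat_adjoint_mult[of _ n n _ n] assoc_mult_mat[of _ n n _ n _ n]
      mult_carrier_mat[of _ n n _ n])

lemma hermitian_index:
  assumes "hermitian n A" "i < n" "j < n"
  shows "cnj (A $$ (j,i)) = A $$ (i,j)"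
proof -
  have "A \<in> carrier_mat n n" "mat_adjoint A = A" using assms by (auto simp: hermitian_def)
  with assms mat_adjoint_index[of i A j] show ?thesis by auto
qed

text \<open>Induction on the dimension. Conjugation by a unitary whose first column is an
  eigenvector turns the first column of A into a multiple of the first unit vector. The result is
  again Hermitian, so its first row has the same shape and the eigenvalue is real. The remaining
  block is Hermitian of size n and is diagonalised by the induction hypothesis.\<close>

lemma hermitian_spec_decomp:
  assumes "hermitian n A"
  shows "\<exists>U l. spec_decomp n A U l"
  using assms
proof (induction n arbitrary: A)
  case 0
  then have "A = 1\<^sub>m 0 * rdiag 0 (\<lambda>_. 0) * mat_adjoint (1\<^sub>m 0)"
    by (intro eq_matI) (auto simp: hermitian_def)
  moreover have "unitary 0 (1\<^sub>m 0)"
    unfolding unitary_def by auto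
  ultimately show ?case unfolding spec_decomp_def by blast
next
  case (Suc n)
  then have A: "A \<in> carrier_mat (Suc n) (Suc n)" by (auto simp: hermitian_def)
  let ?N = "Suc n"
  obtain e v where "eigenvector A v e"
    using spectrum_non_empty[OF A] by (auto simp: spectrum_def eigenvalue_def)
  then have v: "v \<in> carrier_vec ?N" "v \<noteq> 0\<^sub>v ?N" "A *\<^sub>v v = e \<cdot>\<^sub>v v"
    using A by (auto simp: eigenvector_def)
  obtain W c where W: "unitary ?N W" "col W 0 = c \<cdot>\<^sub>v v"
    using unitary_with_first_column[OF v(1,2)] by auto
  have Wc: "W \<in> carrier_mat ?N ?N" using W by (simp add: unitary_carrier)
  define B where "B = mat_adjoint W * A * W"
  have Bh: "hermitian ?N B" unfolding B_def by (rule hermitian_conj[OF Suc.prems Wc])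
  have Bc: "B \<in> carrier_mat ?N ?N" using Bh by (auto simp: hermitian_def)
  have AWc: "(A * W) $$ (r,0) = e * W $$ (r,0)" if "r < ?N" for r
  proof -
    have "col (A * W) 0 = A *\<^sub>v (col W 0)" using A Wc by auto
    also have "\<dots> = c \<cdot>\<^sub>v (A *\<^sub>v v)" using A v W by (simp add: mult_mat_vec)
    also have "\<dots> = e \<cdot>\<^sub>v col W 0" using v(3) W(2) by (simp add: smult_smult_assoc mult.commute)
    finally have "col (A * W) 0 $ r = (e \<cdot>\<^sub>v col W 0) $ r" by simp
    then show ?thesis using A Wc that by simp
  qed
  have B0: "B $$ (i,0) = (if i = 0 then e else 0)" if i: "i < ?N" for i
  proof -
    have "B $$ (i,0) = (mat_adjoint W * (A * W)) $$ (i,0)"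
      unfolding B_def using A Wc by (simp add: assoc_mult_mat[of _ ?N ?N _ ?N _ ?N])
    also have "\<dots> = (\<Sum>r<?N. mat_adjoint W $$ (i,r) * (A * W) $$ (r,0))"
      by (rule mat_mult_index_sum) (use A Wc i in auto)
    also have "\<dots> = e * (\<Sum>r<?N. mat_adjoint W $$ (i,r) * W $$ (r,0))"
      unfolding sum_distrib_left by (intro sum.cong) (auto simp: AWc)
    also have "(\<Sum>r<?N. mat_adjoint W $$ (i,r) * W $$ (r,0)) = (mat_adjoint W * W) $$ (i,0)"
      by (rule mat_mult_index_sum[symmetric]) (use Wc i in auto)
    finally show ?thesis using unitary_adjoint_mult[OF W(1)] i by auto
  qed
  have e_real: "complex_of_real (Re e) = e"
    using hermitian_index[OF Bh, of 0 0] B0[of 0] by (simp add: complex_eq_iff)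
  have B0': "B $$ (0,i) = (if i = 0 then e else 0)" if i: "i < ?N" for i
    using hermitian_index[OF Bh, of 0 i] B0[OF i] B0[of 0] i by auto
  define B' where "B' = mat n n (\<lambda>(i,j). B $$ (Suc i, Suc j))"
  have "hermitian n B'"
    unfolding hermitian_def B'_def
    by (auto intro!: eq_matI hermitian_index[OF Bh])
  from Suc.IH[OF this] obtain U' l' where U': "unitary n U'" "B' = U' * rdiag n l' * mat_adjoint U'"
    by (auto simp: spec_decomp_def)
  have U'c: "U' \<in> carrier_mat n n" using U' by (simp add: unitary_carrier)
  \<comment> \<open>\<open>V\<close> is the direct sum of the 1-by-1 identity and \<open>U'\<close>,
    so that \<open>W * V\<close> diagonalises \<open>A\<close>. Sums over \<open>?N\<close> are
    split at index 0 by \<open>sum.lessThan_Suc_shift\<close>.\<close>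
  define V where "V = mat ?N ?N (\<lambda>(i,j). case i of 0 \<Rightarrow> (case j of 0 \<Rightarrow> 1 | Suc j \<Rightarrow> 0)
     | Suc i \<Rightarrow> (case j of 0 \<Rightarrow> 0 | Suc j \<Rightarrow> U' $$ (i,j)))"
  define l where "l i = (case i of 0 \<Rightarrow> Re e | Suc i \<Rightarrow> l' i)" for i
  have Vc: "V \<in> carrier_mat ?N ?N" by (simp add: V_def)
  have V_index: "V $$ (0,0) = 1" "\<And>j. j < n \<Longrightarrow> V $$ (0,Suc j) = 0" "\<And>i. i < n \<Longrightarrow> V $$ (Suc i,0) = 0"
    "\<And>i j. i < n \<Longrightarrow> j < n \<Longrightarrow> V $$ (Suc i, Suc j) = U' $$ (i,j)"
    by (auto simp: V_def)
  have "mat_adjoint V * V = 1\<^sub>m ?N"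
  proof (rule eq_matI)
    fix i j assume "i < dim_row (1\<^sub>m ?N)" "j < dim_col (1\<^sub>m ?N)"
    then have ij: "i < ?N" "j < ?N" by auto
    have 1: "(mat_adjoint V * V) $$ (i,j) = (\<Sum>r<?N. cnj (V $$ (r,i)) * V $$ (r,j))"
      by (subst mat_mult_index_sum[of _ ?N ?N _ ?N]) (use Vc ij in \<open>auto intro!: sum.cong\<close>)
    have 2: "(\<Sum>r<n. cnj (U' $$ (r,i')) * U' $$ (r,j')) = 1\<^sub>m n $$ (i',j')" if "i' < n" "j' < n" for i' j'
      unfolding unitary_adjoint_mult[OF U'(1), symmetric]
      by (subst mat_mult_index_sum[of _ n n _ n]) (use U'c that in \<open>auto intro!: sum.cong\<close>)
    show "(mat_adjoint V * V) $$ (i,j) = 1\<^sub>m ?N $$ (i,j)"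
      unfolding 1 sum.lessThan_Suc_shift using ij
      by (cases i; cases j) (auto simp: V_index 2)
  qed (use Vc in auto)
  then have Vu: "unitary ?N V" using Vc by (simp add: unitary_def)
  have B_eq: "B = V * rdiag ?N l * mat_adjoint V"
  proof (rule eq_matI)
    fix i j assume "i < dim_row (V * rdiag ?N l * mat_adjoint V)" "j < dim_col (V * rdiag ?N l * mat_adjoint V)"
    then have ij: "i < ?N" "j < ?N" using Vc by auto
    have 1: "(V * rdiag ?N l * mat_adjoint V) $$ (i,j)
        = (\<Sum>r<?N. V $$ (i,r) * complex_of_real (l r) * cnj (V $$ (j,r)))"
      by (subst mat_mult_index_sum[of _ ?N ?N _ ?N])
        (use Vc ij in \<open>auto intro!: sum.cong simp: rdiag_mult_index simp del: index_mult_mat\<close>)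
    have 2: "(\<Sum>r<n. U' $$ (i',r) * complex_of_real (l' r) * cnj (U' $$ (j',r))) = B' $$ (i',j')"
      if "i' < n" "j' < n" for i' j'
      unfolding U'(2)
      by (subst mat_mult_index_sum[of _ n n _ n])
        (use U'c that in \<open>auto intro!: sum.cong simp: rdiag_mult_index simp del: index_mult_mat\<close>)
    show "B $$ (i,j) = (V * rdiag ?N l * mat_adjoint V) $$ (i,j)"
      unfolding 1 sum.lessThan_Suc_shift using ij
      by (cases i; cases j) (auto simp: V_index l_def 2 B0 B0' e_real B'_def)
  qed (use Vc Bc in auto)
  have "A = W * B * mat_adjoint W"
    unfolding B_def using A Wc unitary_mult_cancel[OF W(1)] unitary_mult_adjoint[OF W(1)]
    by (simp add: assoc_mult_mat[of _ ?N ?N _ ?N _ ?N])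
  also have "\<dots> = (W * V) * rdiag ?N l * mat_adjoint (W * V)"
    unfolding B_eq using Wc Vc
    by (simp add: assoc_mult_mat[of _ ?N ?N _ ?N _ ?N] mat_adjoint_mult[of _ ?N ?N _ ?N]
        mult_carrier_mat[of _ ?N ?N _ ?N])
  finally show ?case using unitary_mult[OF W(1) Vu] unfolding spec_decomp_def by blast
qed

subsection \<open>Functional calculus in an eigenbasis\<close>

lemma spec_decomp_carrier: "spec_decomp n A U l \<Longrightarrow> A \<in> carrier_mat n n"
  using unitary_carrier[of n U] by (auto simp: spec_decomp_def intro!: mult_carrier_mat[of _ n n])

text \<open>With Q = V^* U, equating the two decompositions gives Q diag(l) = diag(m) Q, entrywise
  Q_ij l_j = m_i Q_ij. This is the fact behind the independence of both functional calculi from the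
  chosen eigenbasis.\<close>

lemma spec_decomp_intertwine:
  assumes "spec_decomp n A U l" "spec_decomp n A V m" "i < n" "j < n"
    and nz: "(mat_adjoint V * U) $$ (i,j) \<noteq> 0"
  shows "l j = m i"
proof -
  have U: "unitary n U" "U \<in> carrier_mat n n" and V: "unitary n V" "V \<in> carrier_mat n n"
    using assms by (auto simp: spec_decomp_def unitary_carrier)
  have c: "mat_adjoint V * U \<in> carrier_mat n n" using U V by auto
  have "mat_adjoint V * (U * rdiag n l * mat_adjoint U) * U
      = mat_adjoint V * (V * rdiag n m * mat_adjoint V) * U"
    using assms by (simp add: spec_decomp_def)
  then have "(mat_adjoint V * U) * rdiag n l = rdiag n m * (mat_adjoint V * U)"
    using U V by (simp add: assoc_mult_mat[of _ n n _ n _ n] mult_carrier_mat[of _ n n _ n]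
        unitary_adjoint_mult[OF U(1)] unitary_mult_cancel[OF V(1)])
  then have "((mat_adjoint V * U) * rdiag n l) $$ (i,j) = (rdiag n m * (mat_adjoint V * U)) $$ (i,j)"
    by simp
  then show ?thesis using nz by (simp only: rdiag_mult_index[OF c assms(3,4)]) simp
qed

text \<open>The relation Q diag(l) = diag(m) Q passes to f(l) and f(m) entry by entry: where Q has a
  nonzero entry the two eigenvalues agree, and elsewhere both sides are 0.\<close>

lemma spec_decomp_mfun_unique:
  assumes "spec_decomp n A U l" "spec_decomp n A V m"
  shows "V * rdiag n (f \<circ> m) * mat_adjoint V = U * rdiag n (f \<circ> l) * mat_adjoint U"
proof -
  have U: "unitary n U" "U \<in> carrier_mat n n" and V: "unitary n V" "V \<in> carrier_mat n n"
    using assms by (auto simp: spec_decomp_def unitary_carrier)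
  define W where "W = mat_adjoint V * U"
  have W: "W \<in> carrier_mat n n" using U V by (auto simp: W_def)
  have "W * rdiag n (f \<circ> l) = rdiag n (f \<circ> m) * W"
  proof (rule eq_matI)
    fix i j assume "i < dim_row (rdiag n (f \<circ> m) * W)" "j < dim_col (rdiag n (f \<circ> m) * W)"
    then have ij: "i < n" "j < n" using W by auto
    show "(W * rdiag n (f \<circ> l)) $$ (i,j) = (rdiag n (f \<circ> m) * W) $$ (i,j)"
      unfolding rdiag_mult_index[OF W ij]
      using spec_decomp_intertwine[OF assms ij] by (cases "W $$ (i,j) = 0") (auto simp: W_def)
  qed (use W in auto)
  then have "V * (W * rdiag n (f \<circ> l)) * mat_adjoint U = V * (rdiag n (f \<circ> m) * W) * mat_adjoint U"
    by simp
  then show ?thesis unfolding W_def using U V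
    by (simp add: assoc_mult_mat[of _ n n _ n _ n] mult_carrier_mat[of _ n n _ n]
        unitary_mult_adjoint[OF U(1)] unitary_mult_cancel[OF V(1)])
qed

text \<open>By uniqueness, the value picked by \<open>SOME\<close> in \<open>mfun\<close> is the one
  computed from whichever decomposition is at hand.\<close>

lemma mfun_spec_decomp:
  assumes "spec_decomp n A U l"
  shows "mfun f A = U * rdiag n (f \<circ> l) * mat_adjoint U"
proof -
  have "dim_row A = n" using spec_decomp_carrier[OF assms] by auto
  then show ?thesis unfolding mfun_def Let_def
    using assms spec_decomp_mfun_unique[OF assms] by (intro some_equality) blast+
qed

text \<open>As for \<open>mfun\<close>, it suffices to compare two decompositions. For W = V^* U the
  matrix of X changes from Z to W Z W^*. In its (i,j) entry a summand W_ir Z_rs cnj(W_js) can be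
  nonzero only if l_r = m_i and l_s = m_j, so the weight c(m_i, m_j) may be exchanged for c(l_r,
  l_s) term by term.\<close>

lemma jointfun_spec_decomp:
  assumes "spec_decomp n A U l" and X: "X \<in> carrier_mat n n"
  shows "jointfun c A X
    = U * mat n n (\<lambda>(i,j). complex_of_real (c (l i) (l j)) * (mat_adjoint U * X * U) $$ (i,j))
        * mat_adjoint U"
proof -
  define F where "F U l = mat n n (\<lambda>(i,j). complex_of_real (c (l i) (l j)) * (mat_adjoint U * X * U) $$ (i,j))"
    for U and l :: "nat \<Rightarrow> real"
  have F: "F U l \<in> carrier_mat n n" for U l by (simp add: F_def)
  have uniq: "V * F V m * mat_adjoint V = U * F U l * mat_adjoint U" if dV: "spec_decomp n A V m" for V m
  proof -
    have U: "unitary n U" "U \<in> carrier_mat n n" and V: "unitary n V" "V \<in> carrier_mat n n"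
      using assms dV by (auto simp: spec_decomp_def unitary_carrier)
    define W where "W = mat_adjoint V * U"
    define Z where "Z = mat_adjoint U * X * U"
    have W: "W \<in> carrier_mat n n" using U V by (auto simp: W_def)
    have Z: "Z \<in> carrier_mat n n" using U X by (auto simp: Z_def)
    have ZV: "mat_adjoint V * X * V = W * Z * mat_adjoint W"
      unfolding W_def Z_def using U V X
      by (simp add: assoc_mult_mat[of _ n n _ n _ n] mult_carrier_mat[of _ n n _ n]
        mat_adjoint_mult[of _ n n _ n] unitary_mult_cancel[OF U(1)])
    have entry: "(W * G * mat_adjoint W) $$ (i,j)
        = (\<Sum>s<n. \<Sum>r<n. W $$ (i,r) * G $$ (r,s) * cnj (W $$ (j,s)))"
      if "G \<in> carrier_mat n n" "i < n" "j < n" for G i j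
      using that W
      by (subst mat_mult_index_sum[of _ n n _ n])
        (auto simp: sum_distrib_right mat_mult_index_sum[of _ n n _ n] simp del: index_mult_mat
          intro!: sum.cong mult_carrier_mat[of _ n n])
    have "F V m = W * F U l * mat_adjoint W"
    proof (rule eq_matI)
      fix i j assume "i < dim_row (W * F U l * mat_adjoint W)" "j < dim_col (W * F U l * mat_adjoint W)"
      then have ij: "i < n" "j < n" using W by auto
      have "F V m $$ (i,j) = complex_of_real (c (m i) (m j)) * (W * Z * mat_adjoint W) $$ (i,j)"
        using ij by (simp add: F_def ZV del: index_mult_mat)
      also have "\<dots> = (\<Sum>s<n. \<Sum>r<n. complex_of_real (c (m i) (m j)) * (W $$ (i,r) * Z $$ (r,s) * cnj (W $$ (j,s))))"
        unfolding entry[OF Z ij] by (simp add: sum_distrib_left)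
      also have "\<dots> = (\<Sum>s<n. \<Sum>r<n. W $$ (i,r) * F U l $$ (r,s) * cnj (W $$ (j,s)))"
      proof (intro sum.cong refl)
        fix r s assume "r \<in> {..<n}" "s \<in> {..<n}"
        then have rs: "r < n" "s < n" by auto
        have "l r = m i \<and> l s = m j" if "W $$ (i,r) \<noteq> 0" "W $$ (j,s) \<noteq> 0"
          using spec_decomp_intertwine[OF assms(1) dV] that ij rs unfolding W_def by blast
        then show "complex_of_real (c (m i) (m j)) * (W $$ (i,r) * Z $$ (r,s) * cnj (W $$ (j,s)))
            = W $$ (i,r) * F U l $$ (r,s) * cnj (W $$ (j,s))"
          using rs by (cases "W $$ (i,r) = 0 \<or> W $$ (j,s) = 0") (auto simp: F_def Z_def)
      qed
      also have "\<dots> = (W * F U l * mat_adjoint W) $$ (i,j)"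
        by (rule entry[OF F ij, symmetric])
      finally show "F V m $$ (i,j) = (W * F U l * mat_adjoint W) $$ (i,j)" .
    qed (use W F in auto)
    then show ?thesis unfolding W_def using U V F
      by (simp add: assoc_mult_mat[of _ n n _ n _ n] mult_carrier_mat[of _ n n _ n]
        mat_adjoint_mult[of _ n n _ n] unitary_mult_cancel[OF V(1)] unitary_mult_adjoint[OF V(1)])
  qed
  have "dim_row A = n" using spec_decomp_carrier[OF assms(1)] by auto
  then have "jointfun c A X = (SOME Y. \<exists>U l. spec_decomp n A U l \<and> Y = U * F U l * mat_adjoint U)"
    by (simp add: jointfun_def F_def)
  also have "\<dots> = U * F U l * mat_adjoint U"
    using assms(1) uniq by (intro some_equality) blast+
  finally show ?thesis unfolding F_def .
qed

section \<open>The trace inner product and the metric in an eigenbasis\<close>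

lemma mtrace_mult_commute:
  assumes "A \<in> carrier_mat n n" "B \<in> carrier_mat n n"
  shows "mtrace (A * B) = mtrace (B * A)"
proof -
  have "mtrace (A * B) = (\<Sum>i<n. \<Sum>r<n. A $$ (i,r) * B $$ (r,i))"
    using assms by (auto simp: mtrace_def mat_mult_index_sum[of _ n n _ n] simp del: index_mult_mat(1) intro!: sum.cong)
  also have "\<dots> = (\<Sum>r<n. \<Sum>i<n. B $$ (r,i) * A $$ (i,r))"
    by (subst sum.swap) (simp add: mult.commute)
  also have "\<dots> = mtrace (B * A)"
    using assms by (auto simp: mtrace_def mat_mult_index_sum[of _ n n _ n] simp del: index_mult_mat(1) intro!: sum.cong)
  finally show ?thesis .
qed

lemma mtrace_adjoint_mult:
  assumes "A \<in> carrier_mat n n" "B \<in> carrier_mat n n"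
  shows "mtrace (mat_adjoint A * B) = (\<Sum>i<n. \<Sum>j<n. cnj (A $$ (i,j)) * B $$ (i,j))"
proof -
  have "mtrace (mat_adjoint A * B) = (\<Sum>j<n. \<Sum>i<n. cnj (A $$ (i,j)) * B $$ (i,j))"
    using assms by (auto simp: mtrace_def mat_mult_index_sum[of _ n n _ n] simp del: index_mult_mat(1) intro!: sum.cong)
  then show ?thesis by (subst sum.swap)
qed

text \<open>Cyclicity of the trace removes the outer factors U. Thus every trace form below may be
  evaluated in the eigenbasis in which its operator is diagonal.\<close>

lemma mtrace_adjoint_mult_unitary:
  assumes U: "unitary n U" and A: "A \<in> carrier_mat n n" and B: "B \<in> carrier_mat n n"
  shows "mtrace (mat_adjoint (mat_adjoint U * A * U) * (mat_adjoint U * B * U)) = mtrace (mat_adjoint A * B)"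
proof -
  have Uc: "U \<in> carrier_mat n n" using U by (rule unitary_carrier)
  have "mat_adjoint (mat_adjoint U * A * U) * (mat_adjoint U * B * U) = mat_adjoint U * (mat_adjoint A * B * U)"
    using Uc A B
    by (simp add: assoc_mult_mat[of _ n n _ n _ n] mult_carrier_mat[of _ n n _ n]
        mat_adjoint_mult[of _ n n _ n] unitary_mult_cancel[OF U])
  moreover have "mtrace (mat_adjoint U * (mat_adjoint A * B * U)) = mtrace (mat_adjoint A * B * U * mat_adjoint U)"
    by (rule mtrace_mult_commute[of _ n]) (use Uc A B in auto)
  moreover have "mat_adjoint A * B * U * mat_adjoint U = mat_adjoint A * B"
    using Uc A B unitary_mult_adjoint[OF U]
    by (simp add: assoc_mult_mat[of _ n n _ n _ n] mult_carrier_mat[of _ n n _ n])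
  ultimately show ?thesis by simp
qed

text \<open>In an eigenbasis c(L, R) only multiplies the (i,j) entry by c(l_i, l_j), so the trace
  form becomes a weighted sum of squares. In particular the value is real, so \<open>Re\<close> in
  the convexity statements discards nothing.\<close>

lemma Kmetric_spec_decomp:
  assumes "spec_decomp n \<sigma> U l" "X \<in> carrier_mat n n"
  shows "Kmetric f \<sigma> X X
    = complex_of_real (\<Sum>i<n. \<Sum>j<n. MC f (l i) (l j) * (cmod ((mat_adjoint U * X * U) $$ (i,j)))\<^sup>2)"
proof -
  have U: "unitary n U" "U \<in> carrier_mat n n" using assms by (auto simp: spec_decomp_def unitary_carrier)
  define Z where "Z = mat_adjoint U * X * U"
  define F where "F = mat n n (\<lambda>(i,j). complex_of_real (MC f (l i) (l j)) * Z $$ (i,j))"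
  have Z: "Z \<in> carrier_mat n n" and F: "F \<in> carrier_mat n n"
    using U assms by (auto simp: Z_def F_def)
  have "Kmetric f \<sigma> X X = mtrace (mat_adjoint X * (U * F * mat_adjoint U))"
    unfolding Kmetric_def jointfun_spec_decomp[OF assms] F_def Z_def ..
  also have "\<dots> = mtrace (mat_adjoint Z * (mat_adjoint U * (U * F * mat_adjoint U) * U))"
    unfolding Z_def by (rule mtrace_adjoint_mult_unitary[symmetric]) (use U F assms in auto)
  also have "mat_adjoint U * (U * F * mat_adjoint U) * U = F"
    using U F unitary_adjoint_mult[OF U(1)]
    by (simp add: assoc_mult_mat[of _ n n _ n _ n] mult_carrier_mat[of _ n n _ n] unitary_mult_cancel[OF U(1)])
  also have "mtrace (mat_adjoint Z * F) = (\<Sum>i<n. \<Sum>j<n. cnj (Z $$ (i,j)) * F $$ (i,j))"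
    by (rule mtrace_adjoint_mult[OF Z F])
  also have "\<dots> = complex_of_real (\<Sum>i<n. \<Sum>j<n. MC f (l i) (l j) * (cmod (Z $$ (i,j)))\<^sup>2)"
    unfolding of_real_sum
    by (intro sum.cong refl) (auto simp: F_def complex_norm_square mult_ac simp del: of_real_power)
  finally show ?thesis unfolding Z_def .
qed

section \<open>Quadratic forms and positive definiteness in an eigenbasis\<close>

lemma qform_spectral:
  assumes U: "U \<in> carrier_mat n n" and v: "v \<in> carrier_vec n"
  shows "qform n (U * rdiag n l * mat_adjoint U) v
    = complex_of_real (\<Sum>r<n. l r * (cmod (\<Sum>j<n. cnj (U $$ (j,r)) * v $ j))\<^sup>2)"
proof -
  have e: "(U * rdiag n l * mat_adjoint U) $$ (i,j)
      = (\<Sum>r<n. U $$ (i,r) * complex_of_real (l r) * cnj (U $$ (j,r)))" if "i < n" "j < n" for i j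
    by (subst mat_mult_index_sum[of _ n n _ n])
      (use U that in \<open>auto intro!: sum.cong simp: rdiag_mult_index simp del: index_mult_mat\<close>)
  have "qform n (U * rdiag n l * mat_adjoint U) v
      = (\<Sum>i<n. \<Sum>j<n. \<Sum>r<n. complex_of_real (l r) * (cnj (cnj (U $$ (i,r)) * v $ i) * (cnj (U $$ (j,r)) * v $ j)))"
    unfolding qform_def
    by (intro sum.cong refl) (simp add: e sum_distrib_left sum_distrib_right mult_ac del: index_mult_mat)
  also have "\<dots> = (\<Sum>r<n. \<Sum>i<n. \<Sum>j<n. complex_of_real (l r) * (cnj (cnj (U $$ (i,r)) * v $ i) * (cnj (U $$ (j,r)) * v $ j)))"
    by (rule trans[OF sum.cong[OF refl sum.swap] sum.swap])
  also have "\<dots> = (\<Sum>r<n. complex_of_real (l r) *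
      (cnj (\<Sum>i<n. cnj (U $$ (i,r)) * v $ i) * (\<Sum>j<n. cnj (U $$ (j,r)) * v $ j)))"
    unfolding cnj_sum sum_product by (simp only: sum_distrib_left)
  also have "\<dots> = complex_of_real (\<Sum>r<n. l r * (cmod (\<Sum>j<n. cnj (U $$ (j,r)) * v $ j))\<^sup>2)"
    unfolding of_real_sum of_real_mult complex_norm_square by (simp add: mult.commute)
  finally show ?thesis .
qed

lemma hermitian_spectral:
  assumes "spec_decomp n A U l"
  shows "hermitian n A"
proof -
  have U: "U \<in> carrier_mat n n" and A: "A = U * rdiag n l * mat_adjoint U"
    using assms by (auto simp: spec_decomp_def unitary_carrier)
  have "mat_adjoint (rdiag n l) = rdiag n l"
    by (rule eq_matI) (auto simp: rdiag_def)
  then show ?thesis unfolding A hermitian_def using U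
    by (simp add: assoc_mult_mat[of _ n n _ n _ n] mult_carrier_mat[of _ n n _ n] mat_adjoint_mult[of _ n n _ n])
qed

text \<open>At the i-th column of U the quadratic form equals l_i. Conversely, U^* v is nonzero
  whenever v is, so for positive eigenvalues at least one term of the sum of squares is strictly
  positive.\<close>

lemma pd_spectral:
  assumes "spec_decomp n A U l"
  shows "pd n A \<longleftrightarrow> (\<forall>i<n. l i > 0)"
proof -
  have U: "unitary n U" "U \<in> carrier_mat n n" and A: "A = U * rdiag n l * mat_adjoint U"
    using assms by (auto simp: spec_decomp_def unitary_carrier)
  have orth: "(\<Sum>j<n. cnj (U $$ (j,r)) * U $$ (j,i)) = (if r = i then 1 else 0)" if "r < n" "i < n" for r i
  proof -
    have "(mat_adjoint U * U) $$ (r,i) = (\<Sum>j<n. cnj (U $$ (j,r)) * U $$ (j,i))"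
      by (subst mat_mult_index_sum[of _ n n _ n]) (use U that in \<open>auto intro!: sum.cong\<close>)
    then show ?thesis using unitary_adjoint_mult[OF U(1)] that by simp
  qed
  have "l i > 0" if "pd n A" "i < n" for i
  proof -
    define v where "v = col U i"
    have v: "v \<in> carrier_vec n" using U that by (auto simp: v_def)
    have coord: "(\<Sum>j<n. cnj (U $$ (j,r)) * v $ j) = (if r = i then 1 else 0)" if "r < n" for r
      using orth[OF that \<open>i < n\<close>] U \<open>i < n\<close> by (simp add: v_def)
    have "v \<noteq> 0\<^sub>v n" using coord[OF \<open>i < n\<close>] by auto
    then have "0 < Re (qform n A v)" using that v by (auto simp: pd_def)
    also have "Re (qform n A v) = (\<Sum>r<n. if r = i then l i else 0)"
      unfolding A qform_spectral[OF U(2) v] Re_complex_of_real by (intro sum.cong refl) (simp add: coord)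
    finally show ?thesis using that by simp
  qed
  moreover have "pd n A" if l: "\<forall>i<n. l i > 0"
    unfolding pd_def
  proof (intro conjI ballI impI)
    show "hermitian n A" by (rule hermitian_spectral[OF assms])
    fix v :: "complex vec" assume v: "v \<in> carrier_vec n" "v \<noteq> 0\<^sub>v n"
    define z where "z r = (\<Sum>j<n. cnj (U $$ (j,r)) * v $ j)" for r
    have z: "(mat_adjoint U *\<^sub>v v) $ r = z r" if "r < n" for r
      using U v that by (auto simp: z_def scalar_prod_def atLeast0LessThan intro!: sum.cong)
    have "\<exists>r<n. z r \<noteq> 0"
    proof (rule ccontr)
      assume "\<not> ?thesis"
      then have "mat_adjoint U *\<^sub>v v = 0\<^sub>v n" using z U by (intro eq_vecI) (auto simp del: index_mult_mat_vec)
      then have "U *\<^sub>v (mat_adjoint U *\<^sub>v v) = 0\<^sub>v n" using U by (auto intro!: eq_vecI)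
      moreover have "U *\<^sub>v (mat_adjoint U *\<^sub>v v) = (U * mat_adjoint U) *\<^sub>v v"
        using U v by (intro assoc_mult_mat_vec[symmetric, of _ n n _ n]) auto
      ultimately show False using unitary_mult_adjoint[OF U(1)] v by simp
    qed
    then obtain r where r: "r < n" "z r \<noteq> 0" by blast
    have "0 < l r * (cmod (z r))\<^sup>2" using r l by auto
    also have "\<dots> \<le> (\<Sum>r<n. l r * (cmod (z r))\<^sup>2)"
      using l r by (intro member_le_sum) (auto simp: less_imp_le)
    also have "\<dots> = Re (qform n A v)"
      unfolding A qform_spectral[OF U(2) v(1)] z_def by simp
    finally show "0 < Re (qform n A v)" .
  qed
  ultimately show ?thesis by blast
qed

lemma qform_minus:
  assumes "A \<in> carrier_mat n n" "B \<in> carrier_mat n n"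
  shows "qform n (A - B) v = qform n A v - qform n B v"
  using assms unfolding qform_def sum_subtractf[symmetric]
  by (intro sum.cong refl) (auto simp: algebra_simps)

subsection \<open>The operator Jensen inequality\<close>

text \<open>Enumerating \<open>I\<close> and \<open>J\<close> turns both sides into matrices with
  known eigenbases, so \<open>mfun f\<close> simply acts on \<open>a\<close> and \<open>b\<close>,
  and operator monotonicity applies to W^* diag(a) W \<le> diag(b). The index sets stay abstract so
  that block matrices can be indexed by sum types.\<close>

lemma operator_monotone_diagonal:
  fixes W :: "'i \<Rightarrow> 'j \<Rightarrow> complex" and a :: "'i \<Rightarrow> real" and b :: "'j \<Rightarrow> real"
  assumes om: "operator_monotone f" and I: "finite I" and J: "finite J" and card: "card I = card J"
    and orth: "\<And>j j'. j \<in> J \<Longrightarrow> j' \<in> J \<Longrightarrow> (\<Sum>i\<in>I. cnj (W i j) * W i j') = (if j = j' then 1 else 0)"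
    and a: "\<And>i. i \<in> I \<Longrightarrow> a i > 0" and b: "\<And>j. j \<in> J \<Longrightarrow> b j > 0"
    and le: "\<And>x. (\<Sum>i\<in>I. a i * (cmod (\<Sum>j\<in>J. W i j * x j))\<^sup>2) \<le> (\<Sum>j\<in>J. b j * (cmod (x j))\<^sup>2)"
  shows "(\<Sum>i\<in>I. f (a i) * (cmod (\<Sum>j\<in>J. W i j * x j))\<^sup>2) \<le> (\<Sum>j\<in>J. f (b j) * (cmod (x j))\<^sup>2)"
proof -
  define N where "N = card I"
  obtain g where g: "bij_betw g {..<N} I"
    using ex_bij_betw_nat_finite[OF I] by (auto simp: N_def atLeast0LessThan)
  obtain h where h: "bij_betw h {..<N} J"
    using ex_bij_betw_nat_finite[OF J] card by (auto simp: N_def atLeast0LessThan)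
  have gI: "g r \<in> I" and hJ: "h r \<in> J" if "r < N" for r
    using g h that by (auto simp: bij_betw_def)
  have h_inj: "h r = h s \<longleftrightarrow> r = s" if "r < N" "s < N" for r s
    using h that by (auto simp: bij_betw_def inj_on_def)
  define V where "V = mat N N (\<lambda>(r,s). W (g r) (h s))"
  \<comment> \<open>The adjoint is taken because a spectral decomposition has the shape U diag U^*
    while the left side here is V^* diag(a) V.\<close>
  define U where "U = mat_adjoint V"
  have V: "V \<in> carrier_mat N N" by (simp add: V_def)
  have "mat_adjoint V * V = 1\<^sub>m N"
  proof (rule eq_matI)
    fix r s assume "r < dim_row (1\<^sub>m N)" "s < dim_col (1\<^sub>m N)"
    then have rs: "r < N" "s < N" by auto
    have "(mat_adjoint V * V) $$ (r,s) = (\<Sum>t<N. cnj (W (g t) (h r)) * W (g t) (h s))"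
      by (subst mat_mult_index_sum[of _ N N _ N]) (use V rs in \<open>auto intro!: sum.cong simp: V_def\<close>)
    also have "\<dots> = (\<Sum>i\<in>I. cnj (W i (h r)) * W i (h s))"
      by (rule sum.reindex_bij_betw[OF g])
    finally show "(mat_adjoint V * V) $$ (r,s) = 1\<^sub>m N $$ (r,s)"
      using orth[OF hJ hJ] rs h_inj by auto
  qed (use V in auto)
  then have U: "unitary N U" unfolding U_def using V by (intro unitary_adjoint) (simp add: unitary_def)
  have Uc: "U \<in> carrier_mat N N" using U by (rule unitary_carrier)
  have one: "mat_adjoint (1\<^sub>m N) = (1\<^sub>m N :: complex mat)" by (rule eq_matI) auto
  have one_unitary: "unitary N (1\<^sub>m N)" unfolding unitary_def one by simp
  define SA where "SA c = U * rdiag N (c \<circ> g) * mat_adjoint U" for c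
  define SB where "SB c = 1\<^sub>m N * rdiag N (c \<circ> h) * mat_adjoint (1\<^sub>m N)" for c
  define vx where "vx x = vec N (\<lambda>s. x (h s))" for x :: "'j \<Rightarrow> complex"
  have SA_carrier: "SA c \<in> carrier_mat N N" and SB_carrier: "SB d \<in> carrier_mat N N" for c d
    using Uc by (auto simp: SA_def SB_def one)
  have dA: "spec_decomp N (SA c) U (c \<circ> g)" for c
    using U by (simp add: spec_decomp_def SA_def)
  have dB: "spec_decomp N (SB c) (1\<^sub>m N) (c \<circ> h)" for c
    using one_unitary by (simp add: spec_decomp_def SB_def)
  have vx: "vx x \<in> carrier_vec N" for x by (simp add: vx_def)
  \<comment> \<open>Every vector comes from a function on \<open>J\<close>, so \<open>le\<close>
    covers all the vectors over which \<open>psd\<close> quantifies.\<close>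
  have vx_surj: "\<exists>x. v = vx x" if "v \<in> carrier_vec N" for v
    by (rule exI[of _ "\<lambda>j. v $ inv_into {..<N} h j"])
      (use that h in \<open>auto simp: vx_def bij_betw_def intro!: eq_vecI\<close>)
  have qA: "Re (qform N (SA c) (vx x)) = (\<Sum>i\<in>I. c i * (cmod (\<Sum>j\<in>J. W i j * x j))\<^sup>2)" for c x
  proof -
    have "Re (qform N (SA c) (vx x)) = (\<Sum>r<N. c (g r) * (cmod (\<Sum>s<N. W (g r) (h s) * x (h s)))\<^sup>2)"
      unfolding SA_def qform_spectral[OF Uc vx] Re_complex_of_real
      by (intro sum.cong refl arg_cong2[where f = "(*)"] arg_cong[where f = "\<lambda>z. (cmod z)\<^sup>2"])
        (auto simp: U_def vx_def V_def)
    also have "\<dots> = (\<Sum>r<N. c (g r) * (cmod (\<Sum>j\<in>J. W (g r) j * x j))\<^sup>2)"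
      by (intro sum.cong refl arg_cong2[where f = "(*)"] arg_cong[where f = "\<lambda>z. (cmod z)\<^sup>2"]
          sum.reindex_bij_betw[OF h, of "\<lambda>j. W (g _) j * x j"])
    also have "\<dots> = (\<Sum>i\<in>I. c i * (cmod (\<Sum>j\<in>J. W i j * x j))\<^sup>2)"
      by (rule sum.reindex_bij_betw[OF g])
    finally show ?thesis .
  qed
  have qB: "Re (qform N (SB c) (vx x)) = (\<Sum>j\<in>J. c j * (cmod (x j))\<^sup>2)" for c x
  proof -
    have "(\<Sum>s<N. cnj (1\<^sub>m N $$ (s,r)) * vx x $ s) = x (h r)" if "r < N" for r
    proof -
      have "(\<Sum>s<N. cnj (1\<^sub>m N $$ (s,r)) * vx x $ s) = (\<Sum>s<N. if s = r then x (h r) else 0)"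
        using that by (intro sum.cong) (auto simp: vx_def)
      then show ?thesis using that by simp
    qed
    then have "Re (qform N (SB c) (vx x)) = (\<Sum>r<N. c (h r) * (cmod (x (h r)))\<^sup>2)"
      unfolding SB_def qform_spectral[OF one_carrier_mat vx] Re_complex_of_real by simp
    also have "\<dots> = (\<Sum>j\<in>J. c j * (cmod (x j))\<^sup>2)"
      by (rule sum.reindex_bij_betw[OF h])
    finally show ?thesis .
  qed
  have qdiff: "Re (qform N (SB c - SA d) (vx x))
      = (\<Sum>j\<in>J. c j * (cmod (x j))\<^sup>2) - (\<Sum>i\<in>I. d i * (cmod (\<Sum>j\<in>J. W i j * x j))\<^sup>2)" for c d x
    by (simp add: qform_minus[OF SB_carrier SA_carrier] qA qB)
  have pdA: "pd N (SA a)" unfolding pd_spectral[OF dA] using a gI by auto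
  have pdB: "pd N (SB b)" unfolding pd_spectral[OF dB] using b hJ by auto
  have "hermitian N (SB b - SA a)"
    using hermitian_index[OF hermitian_spectral[OF dA]] hermitian_index[OF hermitian_spectral[OF dB]]
      SA_carrier[of a] SB_carrier[of b]
    unfolding hermitian_def by (auto intro!: eq_matI)
  then have "psd N (SB b - SA a)"
    unfolding psd_def using vx_surj qdiff le by fastforce
  then have "psd N (mfun f (SB b) - mfun f (SA a))"
    using om pdA pdB unfolding operator_monotone_def by blast
  moreover have "mfun f (SA a) = SA (f \<circ> a)" "mfun f (SB b) = SB (f \<circ> b)"
    using mfun_spec_decomp[OF dA] mfun_spec_decomp[OF dB] by (simp_all add: SA_def SB_def o_assoc)
  ultimately have "0 \<le> Re (qform N (SB (f \<circ> b) - SA (f \<circ> a)) (vx x))"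
    using vx by (auto simp: psd_def)
  then show ?thesis unfolding qdiff by simp
qed

section \<open>Isometries and orthonormal columns\<close>

lemma cmod_add_squared: "(cmod (u + v))\<^sup>2 = (cmod u)\<^sup>2 + (cmod v)\<^sup>2 + 2 * Re (cnj u * v)"
  unfolding cmod_power2 by (simp add: power2_eq_square algebra_simps)

text \<open>Polarisation: unit vectors give the norms of the columns, and e_j + q e_j' with q = 1
  and q = \<i> shows that the real and imaginary parts of the inner product of two columns
  vanish.\<close>

lemma orthonormal_columns_if_isometric:
  fixes C :: "'i \<Rightarrow> 'j \<Rightarrow> complex"
  assumes J: "finite J"
    and iso: "\<And>x. (\<Sum>i\<in>I. (cmod (\<Sum>j\<in>J. C i j * x j))\<^sup>2) = (\<Sum>j\<in>J. (cmod (x j))\<^sup>2)"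
    and j: "j \<in> J" "j' \<in> J"
  shows "(\<Sum>i\<in>I. cnj (C i j) * C i j') = (if j = j' then 1 else 0)"
proof -
  have norm1: "(\<Sum>i\<in>I. (cmod (C i k))\<^sup>2) = 1" if "k \<in> J" for k
  proof -
    have "(\<Sum>j\<in>J. C i j * (if j = k then 1 else 0)) = C i k" for i
      using J that by (simp add: if_distrib[of "\<lambda>z. C i _ * z"] cong: if_cong)
    moreover have "(\<Sum>j\<in>J. (cmod (if j = k then 1 else 0))\<^sup>2) = (1::real)"
      using J that by (simp add: if_distrib[of cmod] if_distrib[of "\<lambda>z. z\<^sup>2"] cong: if_cong)
    ultimately show ?thesis using iso[of "\<lambda>j. if j = k then 1 else 0"] by simp
  qed
  show ?thesis
  proof (cases "j = j'")
    case True
    have "(\<Sum>i\<in>I. cnj (C i j) * C i j) = complex_of_real (\<Sum>i\<in>I. (cmod (C i j))\<^sup>2)"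
      unfolding of_real_sum complex_norm_square by (simp add: mult.commute)
    also have "\<dots> = 1" by (simp only: norm1[OF j(1)] of_real_1)
    finally show ?thesis using True by simp
  next
    case False
    have cross: "Re (q * (\<Sum>i\<in>I. cnj (C i j) * C i j')) = 0" if q: "cmod q = 1" for q
    proof -
      define x where "x k = (if k = j then 1 else if k = j' then q else 0)" for k
      have split: "sum F J = F j + F j'" if "\<And>k. k \<noteq> j \<Longrightarrow> k \<noteq> j' \<Longrightarrow> F k = 0" for F :: "'j \<Rightarrow> 'z::comm_monoid_add"
      proof -
        have "sum F J = sum F {j,j'}"
          using J j that by (intro sum.mono_neutral_right) auto
        then show ?thesis using False by simp
      qed
      have "(\<Sum>k\<in>J. C i k * x k) = C i j + q * C i j'" for i
        using False by (subst split) (auto simp: x_def)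
      moreover have "(\<Sum>k\<in>J. (cmod (x k))\<^sup>2) = 2"
        using False q by (subst split) (auto simp: x_def)
      ultimately have "(\<Sum>i\<in>I. (cmod (C i j + q * C i j'))\<^sup>2) = 2"
        using iso[of x] by simp
      then have "(\<Sum>i\<in>I. (cmod (C i j))\<^sup>2) + (\<Sum>i\<in>I. (cmod (C i j'))\<^sup>2)
          + 2 * (\<Sum>i\<in>I. Re (q * (cnj (C i j) * C i j'))) = 2"
        by (simp add: cmod_add_squared norm_mult q sum.distrib sum_distrib_left mult.left_commute[of "cnj _" q])
      then have "(\<Sum>i\<in>I. Re (q * (cnj (C i j) * C i j'))) = 0"
        using norm1[OF j(1)] norm1[OF j(2)] by linarith
      then show ?thesis by (simp only: sum_distrib_left Re_sum)
    qed
    show ?thesis using cross[of 1] cross[of \<i>] False by (simp add: complex_eq_iff)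
  qed
qed

lemma isometric_if_orthonormal_columns:
  fixes C :: "'i \<Rightarrow> 'j \<Rightarrow> complex"
  assumes J: "finite J"
    and orth: "\<And>j j'. j \<in> J \<Longrightarrow> j' \<in> J \<Longrightarrow> (\<Sum>i\<in>I. cnj (C i j) * C i j') = (if j = j' then 1 else 0)"
  shows "(\<Sum>i\<in>I. (cmod (\<Sum>j\<in>J. C i j * x j))\<^sup>2) = (\<Sum>j\<in>J. (cmod (x j))\<^sup>2)"
proof -
  have "complex_of_real (\<Sum>i\<in>I. (cmod (\<Sum>j\<in>J. C i j * x j))\<^sup>2)
      = (\<Sum>i\<in>I. (\<Sum>j\<in>J. C i j * x j) * cnj (\<Sum>j\<in>J. C i j * x j))"
    unfolding of_real_sum complex_norm_square ..
  also have "\<dots> = (\<Sum>i\<in>I. \<Sum>j\<in>J. \<Sum>j'\<in>J. x j * cnj (x j') * (cnj (C i j') * C i j))"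
    unfolding cnj_sum sum_product by (simp add: mult_ac)
  also have "\<dots> = (\<Sum>j\<in>J. \<Sum>j'\<in>J. \<Sum>i\<in>I. x j * cnj (x j') * (cnj (C i j') * C i j))"
    by (rule trans[OF sum.swap sum.cong[OF refl sum.swap]])
  also have "\<dots> = (\<Sum>j\<in>J. \<Sum>j'\<in>J. if j' = j then x j * cnj (x j) else 0)"
    by (intro sum.cong refl) (simp add: sum_distrib_left[symmetric] orth)
  also have "\<dots> = complex_of_real (\<Sum>j\<in>J. (cmod (x j))\<^sup>2)"
    unfolding of_real_sum complex_norm_square using J by simp
  finally show ?thesis by (simp only: of_real_eq_iff)
qed

section \<open>Scalar bounds for functions in \<open>Fop\<close>\<close>

lemma Fop_mono:
  assumes "Fop f" "0 < s" "s \<le> t"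
  shows "f s \<le> f t"
proof -
  have om: "operator_monotone f" using assms unfolding Fop_def by blast
  \<comment> \<open>A 1-by-1 matrix is a number, so operator monotonicity with both index sets
    \<open>{()}\<close> and the entry 1 is ordinary monotonicity.\<close>
  have "(\<Sum>i\<in>{()}. f s * (cmod (\<Sum>j\<in>{()}. 1 * 1))\<^sup>2) \<le> (\<Sum>j\<in>{()}. f t * (cmod 1)\<^sup>2)"
    by (rule operator_monotone_diagonal[OF om, where I = "{()}" and J = "{()}" and W = "\<lambda>_ _. 1"
          and a = "\<lambda>_. s" and b = "\<lambda>_. t" and x = "\<lambda>_. 1"])
      (use assms in \<open>auto intro!: mult_right_mono\<close>)
  then show ?thesis by simp
qed

text \<open>By symmetry f(s) / s = f(1/s), which is decreasing because f is increasing. The bound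
  later takes the factor 1 + \<delta> out of the argument of f.\<close>

lemma Fop_scale_le:
  assumes f: "Fop f" and "0 < t" "1 \<le> c"
  shows "f (c * t) \<le> c * f t"
proof -
  have sym: "f s = s * f (inverse s)" if "s > 0" for s using f that unfolding Fop_def by blast
  have "f (inverse (c * t)) \<le> f (inverse t)"
    by (rule Fop_mono[OF f]) (use assms in \<open>auto simp: inverse_le_1_iff\<close>)
  then have "c * t * f (inverse (c * t)) \<le> c * (t * f (inverse t))"
    unfolding mult.assoc[symmetric] using assms by (intro mult_left_mono) auto
  moreover have "f (c * t) = c * t * f (inverse (c * t))"
    by (rule sym) (use assms in auto)
  moreover have "f t = t * f (inverse t)"
    by (rule sym) (use assms in auto)
  ultimately show ?thesis by (simp only:)
qed

text \<open>Young's inequality with weight \<delta>: after the triangle inequality the two sides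
  differ by (\<delta> |u| - |v|)^2 / \<delta>. In the dilation u comes from the first block and v
  from the second, so a factor near 1 is paid on the first and a large one on the second.\<close>

lemma cmod_add_squared_le:
  assumes "\<delta> > 0"
  shows "(cmod (u + v))\<^sup>2 \<le> (1 + \<delta>) * (cmod u)\<^sup>2 + (1 + 1 / \<delta>) * (cmod v)\<^sup>2"
proof -
  have "cmod (u + v) \<le> cmod u + cmod v" by (rule norm_triangle_ineq)
  then have "(cmod (u + v))\<^sup>2 \<le> (cmod u + cmod v)\<^sup>2" by (rule power_mono) simp
  also have "(cmod u + cmod v)\<^sup>2
      = (1 + \<delta>) * (cmod u)\<^sup>2 + (1 + 1 / \<delta>) * (cmod v)\<^sup>2 - (\<delta> * cmod u - cmod v)\<^sup>2 / \<delta>"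
    using assms by (simp add: field_simps power2_eq_square)
  also have "\<dots> \<le> (1 + \<delta>) * (cmod u)\<^sup>2 + (1 + 1 / \<delta>) * (cmod v)\<^sup>2"
    using assms by simp
  finally show ?thesis .
qed

text \<open>Halmos dilation: the unitary block matrix with rows (C, 1 - C C*) and (0, - C*), for an isometry C.\<close>

definition dilation :: "'i set \<Rightarrow> 'j set \<Rightarrow> ('i \<Rightarrow> 'j \<Rightarrow> complex) \<Rightarrow> 'i + 'j \<Rightarrow> 'j + 'i \<Rightarrow> complex" where
  "dilation I J C = case_sum
     (\<lambda>i. case_sum (C i) (\<lambda>k. (if i = k then 1 else 0) - (\<Sum>j\<in>J. C i j * cnj (C k j))))
     (\<lambda>j. case_sum (\<lambda>_. 0) (\<lambda>k. - cnj (C k j)))"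

lemma dilation_simps [simp]:
  "dilation I J C (Inl i) (Inl j) = C i j"
  "dilation I J C (Inl i) (Inr k) = (if i = k then 1 else 0) - (\<Sum>j\<in>J. C i j * cnj (C k j))"
  "dilation I J C (Inr j) (Inl j') = 0"
  "dilation I J C (Inr j) (Inr k) = - cnj (C k j)"
  by (simp_all add: dilation_def)

text \<open>With P = C C^* the relation C^* C = 1 gives C^* P = C^* and P P = P. Hence C^* (1 - P) =
  0, which makes the two block columns orthogonal, and (1 - P)^2 + C C^* = 1, which makes the second
  one orthonormal.\<close>

lemma dilation_orthonormal:
  fixes C :: "'i \<Rightarrow> 'j \<Rightarrow> complex"
  assumes I: "finite I" and J: "finite J"
    and orth: "\<And>j j'. j \<in> J \<Longrightarrow> j' \<in> J \<Longrightarrow> (\<Sum>i\<in>I. cnj (C i j) * C i j') = (if j = j' then 1 else 0)"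
    and p: "p \<in> J <+> I" "q \<in> J <+> I"
  shows "(\<Sum>i\<in>I <+> J. cnj (dilation I J C i p) * dilation I J C i q) = (if p = q then 1 else 0)"
proof -
  define P where "P i k = (\<Sum>j\<in>J. C i j * cnj (C k j))" for i k
  have delta: "(\<Sum>i\<in>I. (if i = k then 1 else 0) * F i) = F k" if "k \<in> I" for k and F :: "'i \<Rightarrow> complex"
  proof -
    have "(\<Sum>i\<in>I. (if i = k then 1 else 0) * F i) = (\<Sum>i\<in>I. if i = k then F k else 0)"
      by (intro sum.cong) auto
    then show ?thesis using I that by simp
  qed
  have cnj_P: "cnj (P i k) = P k i" for i k
    unfolding P_def by (simp add: mult.commute)
  have CP: "(\<Sum>i\<in>I. cnj (C i j) * P i k) = cnj (C k j)" if "j \<in> J" for j k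
  proof -
    have "(\<Sum>i\<in>I. cnj (C i j) * P i k) = (\<Sum>i\<in>I. \<Sum>j'\<in>J. cnj (C i j) * C i j' * cnj (C k j'))"
      by (simp add: P_def sum_distrib_left mult.assoc)
    also have "\<dots> = (\<Sum>j'\<in>J. \<Sum>i\<in>I. cnj (C i j) * C i j' * cnj (C k j'))"
      by (rule sum.swap)
    also have "\<dots> = (\<Sum>j'\<in>J. if j' = j then cnj (C k j) else 0)"
      using that by (intro sum.cong refl) (simp add: sum_distrib_right[symmetric] orth)
    finally show ?thesis using J that by simp
  qed
  have PP: "(\<Sum>i\<in>I. P k i * P i k') = P k k'" for k k'
  proof -
    have "(\<Sum>i\<in>I. P k i * P i k') = (\<Sum>i\<in>I. \<Sum>j\<in>J. C k j * (cnj (C i j) * P i k'))"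
      by (simp add: P_def[of k] sum_distrib_right mult.assoc)
    also have "\<dots> = (\<Sum>j\<in>J. \<Sum>i\<in>I. C k j * (cnj (C i j) * P i k'))"
      by (rule sum.swap)
    also have "\<dots> = (\<Sum>j\<in>J. C k j * cnj (C k' j))"
      by (intro sum.cong refl) (simp add: sum_distrib_left[symmetric] CP)
    finally show ?thesis by (simp add: P_def)
  qed
  have LR: "(\<Sum>i\<in>I. cnj (C i j) * ((if i = k then 1 else 0) - P i k)) = 0" if "j \<in> J" "k \<in> I" for j k
    using delta[OF that(2), of "\<lambda>i. cnj (C i j)"] CP[OF that(1)]
    by (simp add: right_diff_distrib sum_subtractf mult.commute[of "cnj _" "if _ then _ else _"])
  have RL: "(\<Sum>i\<in>I. cnj ((if i = k then 1 else 0) - P i k) * C i j) = 0" if "j \<in> J" "k \<in> I" for j k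
  proof -
    have "(\<Sum>i\<in>I. cnj ((if i = k then 1 else 0) - P i k) * C i j)
        = cnj (\<Sum>i\<in>I. cnj (C i j) * ((if i = k then 1 else 0) - P i k))"
      unfolding cnj_sum by (simp add: mult.commute)
    then show ?thesis using LR[OF that] by simp
  qed
  have RR: "(\<Sum>i\<in>I. cnj ((if i = k then 1 else 0) - P i k) * ((if i = k' then 1 else 0) - P i k'))
      = (if k = k' then 1 else 0) - P k k'" if "k \<in> I" "k' \<in> I" for k k'
  proof -
    have "(\<Sum>i\<in>I. cnj ((if i = k then 1 else 0) - P i k) * ((if i = k' then 1 else 0) - P i k'))
       = (\<Sum>i\<in>I. (if i = k then 1 else 0) * ((if i = k' then 1 else 0) - P i k')
           - (if i = k' then 1 else 0) * P k i + P k i * P i k')"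
      by (intro sum.cong refl) (auto simp: cnj_P algebra_simps)
    also have "\<dots> = (if k = k' then 1 else 0) - P k k' - P k k' + P k k'"
      unfolding sum.distrib sum_subtractf delta[OF that(1)] delta[OF that(2)] PP by simp
    finally show ?thesis by simp
  qed
  note simps = sum.Plus[OF I J] P_def[symmetric]
  consider j j' where "p = Inl j" "q = Inl j'" "j \<in> J" "j' \<in> J"
    | j k where "p = Inl j" "q = Inr k" "j \<in> J" "k \<in> I"
    | k j where "p = Inr k" "q = Inl j" "k \<in> I" "j \<in> J"
    | k k' where "p = Inr k" "q = Inr k'" "k \<in> I" "k' \<in> I"
    using p by auto
  then show ?thesis
  proof cases
    case 1
    then show ?thesis by (simp add: simps orth)
  next
    case 2
    then show ?thesis by (simp add: simps LR)
  next
    case 3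
    then show ?thesis by (simp add: simps RL del: complex_cnj_diff)
  next
    case 4
    then show ?thesis by (simp add: simps RR del: complex_cnj_diff)
  qed
qed

text \<open>Monotonicity for the dilated matrices proves the claim up to a factor 1 + \<delta> for
  every \<delta> > 0. Both operators are given diagonally, in bases indexed by \<open>I\<close> and
  \<open>J\<close>, and \<open>le\<close> says C^* diag(a) C \<le> diag(b).\<close>

lemma isometric_Jensen:
  fixes C :: "'i \<Rightarrow> 'j \<Rightarrow> complex" and a :: "'i \<Rightarrow> real" and b :: "'j \<Rightarrow> real"
  assumes f: "Fop f" and I: "finite I" and J: "finite J"
    and iso: "\<And>x. (\<Sum>i\<in>I. (cmod (\<Sum>j\<in>J. C i j * x j))\<^sup>2) = (\<Sum>j\<in>J. (cmod (x j))\<^sup>2)"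
    and a: "\<And>i. i \<in> I \<Longrightarrow> a i > 0" and b: "\<And>j. j \<in> J \<Longrightarrow> b j > 0"
    and le: "\<And>x. (\<Sum>i\<in>I. a i * (cmod (\<Sum>j\<in>J. C i j * x j))\<^sup>2) \<le> (\<Sum>j\<in>J. b j * (cmod (x j))\<^sup>2)"
  shows "(\<Sum>i\<in>I. f (a i) * (cmod (\<Sum>j\<in>J. C i j * x j))\<^sup>2) \<le> (\<Sum>j\<in>J. f (b j) * (cmod (x j))\<^sup>2)"
    (is "?L \<le> ?R")
proof -
  have om: "operator_monotone f" and fpos: "\<And>t. t > 0 \<Longrightarrow> f t > 0" using f unfolding Fop_def by blast+
  have orth: "(\<Sum>i\<in>I. cnj (C i j) * C i j') = (if j = j' then 1 else 0)" if "j \<in> J" "j' \<in> J" for j j'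
    by (rule orthonormal_columns_if_isometric[OF J iso that])
  let ?W = "dilation I J C"
  note W_orth = dilation_orthonormal[OF I J orth]
  have IJ: "finite (J <+> I)" using I J by simp
  note W_iso = isometric_if_orthonormal_columns[OF IJ W_orth]
  have approx: "?L \<le> (1 + \<delta>) * ?R" if \<delta>: "\<delta> > 0" for \<delta>
  proof -
    \<comment> \<open>\<open>M\<close> must dominate (1 + 1/\<delta>) a_i for each i, for which the
      sum of all a_i serves as a bound, and also the entry 1 that \<open>a'\<close> has on the added
      block, whence the final \<open>+ 1\<close>.\<close>
    define M where "M = (1 + 1 / \<delta>) * (\<Sum>i\<in>I. a i) + 1"
    have a_sum: "a i \<le> (\<Sum>i\<in>I. a i)" if "i \<in> I" for i
      using that a I by (intro member_le_sum) (auto simp: less_imp_le)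
    have a_nonneg: "0 \<le> (\<Sum>i\<in>I. a i)" using a by (intro sum_nonneg) (auto simp: less_imp_le)
    have M: "M \<ge> 1" unfolding M_def using a_nonneg \<delta> by simp
    have Ma: "(1 + 1 / \<delta>) * a i \<le> M" if "i \<in> I" for i
      unfolding M_def using mult_left_mono[OF a_sum[OF that], of "1 + 1 / \<delta>"] \<delta> by simp
    define a' where "a' = case_sum a (\<lambda>_::'j. 1::real)"
    define b' where "b' = case_sum (\<lambda>j. (1 + \<delta>) * b j) (\<lambda>_::'i. M)"
    have main: "(\<Sum>i\<in>I <+> J. a' i * (cmod (\<Sum>j\<in>J <+> I. ?W i j * y j))\<^sup>2)
        \<le> (\<Sum>j\<in>J <+> I. b' j * (cmod (y j))\<^sup>2)" for y
    proof -
      define u where "u i = (\<Sum>j\<in>J. C i j * y (Inl j))" for i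
      define t where "t i = (\<Sum>k\<in>I. ?W (Inl i) (Inr k) * y (Inr k))" for i
      define s where "s j = (\<Sum>k\<in>I. ?W (Inr j) (Inr k) * y (Inr k))" for j
      have 1: "(\<Sum>j\<in>J <+> I. ?W (Inl i) j * y j) = u i + t i"
        "(\<Sum>k\<in>J <+> I. ?W (Inr j) k * y k) = s j" for i j
        by (simp_all add: sum.Plus[OF J I] u_def t_def s_def)
      \<comment> \<open>Applied to the part of \<open>y\<close> on the second block, the dilation
        has components \<open>t\<close> and \<open>s\<close>; being isometric, it controls both at
        once by the norm of that part.\<close>
      have ts: "(\<Sum>i\<in>I. (cmod (t i))\<^sup>2) + (\<Sum>j\<in>J. (cmod (s j))\<^sup>2) = (\<Sum>k\<in>I. (cmod (y (Inr k)))\<^sup>2)"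
        using W_iso[of "case_sum (\<lambda>_. 0) (\<lambda>k. y (Inr k))"]
        by (simp add: sum.Plus[OF I J] sum.Plus[OF J I] t_def s_def)
      have split: "(\<Sum>i\<in>I <+> J. a' i * (cmod (\<Sum>j\<in>J <+> I. ?W i j * y j))\<^sup>2)
          = (\<Sum>i\<in>I. a i * (cmod (u i + t i))\<^sup>2) + (\<Sum>j\<in>J. (cmod (s j))\<^sup>2)"
        by (subst sum.Plus[OF I J]) (simp add: 1 a'_def)
      have "(\<Sum>i\<in>I. a i * (cmod (u i + t i))\<^sup>2)
          \<le> (\<Sum>i\<in>I. (1 + \<delta>) * (a i * (cmod (u i))\<^sup>2) + M * (cmod (t i))\<^sup>2)"
      proof (rule sum_mono)
        fix i assume i: "i \<in> I"
        have "a i * (cmod (u i + t i))\<^sup>2 \<le> a i * ((1 + \<delta>) * (cmod (u i))\<^sup>2 + (1 + 1 / \<delta>) * (cmod (t i))\<^sup>2)"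
          using a[OF i] by (intro mult_left_mono cmod_add_squared_le \<delta>) simp
        also have "\<dots> = (1 + \<delta>) * (a i * (cmod (u i))\<^sup>2) + (1 + 1 / \<delta>) * a i * (cmod (t i))\<^sup>2"
          by (simp add: algebra_simps)
        also have "\<dots> \<le> (1 + \<delta>) * (a i * (cmod (u i))\<^sup>2) + M * (cmod (t i))\<^sup>2"
          using Ma[OF i] by (intro add_left_mono mult_right_mono) auto
        finally show "a i * (cmod (u i + t i))\<^sup>2 \<le> (1 + \<delta>) * (a i * (cmod (u i))\<^sup>2) + M * (cmod (t i))\<^sup>2" .
      qed
      also have "\<dots> = (1 + \<delta>) * (\<Sum>i\<in>I. a i * (cmod (u i))\<^sup>2) + M * (\<Sum>i\<in>I. (cmod (t i))\<^sup>2)"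
        by (simp add: sum.distrib sum_distrib_left)
      finally have ut: "(\<Sum>i\<in>I. a i * (cmod (u i + t i))\<^sup>2)
          \<le> (1 + \<delta>) * (\<Sum>i\<in>I. a i * (cmod (u i))\<^sup>2) + M * (\<Sum>i\<in>I. (cmod (t i))\<^sup>2)" .
      have "(1 + \<delta>) * (\<Sum>i\<in>I. a i * (cmod (u i))\<^sup>2) \<le> (1 + \<delta>) * (\<Sum>j\<in>J. b j * (cmod (y (Inl j)))\<^sup>2)"
        unfolding u_def using \<delta> by (intro mult_left_mono le) simp
      moreover have "(\<Sum>j\<in>J. (cmod (s j))\<^sup>2) \<le> M * (\<Sum>j\<in>J. (cmod (s j))\<^sup>2)"
        using mult_right_mono[OF M, of "\<Sum>j\<in>J. (cmod (s j))\<^sup>2"] by (simp add: sum_nonneg)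
      ultimately have "(\<Sum>i\<in>I <+> J. a' i * (cmod (\<Sum>j\<in>J <+> I. ?W i j * y j))\<^sup>2)
          \<le> (1 + \<delta>) * (\<Sum>j\<in>J. b j * (cmod (y (Inl j)))\<^sup>2)
            + M * ((\<Sum>i\<in>I. (cmod (t i))\<^sup>2) + (\<Sum>j\<in>J. (cmod (s j))\<^sup>2))"
        unfolding split distrib_left[of M] using ut by linarith
      also have "\<dots> = (\<Sum>j\<in>J <+> I. b' j * (cmod (y j))\<^sup>2)"
        unfolding ts by (subst sum.Plus[OF J I]) (simp add: b'_def sum_distrib_left mult.assoc)
      finally show ?thesis .
    qed
    \<comment> \<open>A test vector supported on the first block. Its image has no component on the
      added copy of \<open>J\<close>, so f(1) drops out on the left and f(M) on the right, and the
      size of \<open>M\<close> no longer matters.\<close>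
    define y where "y = case_sum x (\<lambda>_::'i. 0)"
    have "(\<Sum>i\<in>I <+> J. f (a' i) * (cmod (\<Sum>j\<in>J <+> I. ?W i j * y j))\<^sup>2)
        \<le> (\<Sum>j\<in>J <+> I. f (b' j) * (cmod (y j))\<^sup>2)"
      by (rule operator_monotone_diagonal[OF om _ IJ _ W_orth _ _ main])
        (use I J a b \<delta> M in \<open>auto simp: a'_def b'_def card_Plus\<close>)
    then have "?L \<le> (\<Sum>j\<in>J. f ((1 + \<delta>) * b j) * (cmod (x j))\<^sup>2)"
      by (simp add: sum.Plus[OF I J] sum.Plus[OF J I] a'_def b'_def y_def)
    also have "\<dots> \<le> (\<Sum>j\<in>J. (1 + \<delta>) * f (b j) * (cmod (x j))\<^sup>2)"
      using \<delta> b by (intro sum_mono mult_right_mono Fop_scale_le[OF f]) auto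
    also have "\<dots> = (1 + \<delta>) * ?R" by (simp add: sum_distrib_left mult.assoc)
    finally show ?thesis .
  qed
  have R: "?R \<ge> 0" using fpos b by (intro sum_nonneg) (auto simp: less_imp_le)
  show ?thesis
  proof (rule field_le_epsilon)
    fix e :: real assume e: "e > 0"
    \<comment> \<open>The choice \<delta> = e / (\<open>?R\<close> + 1) makes \<delta>
      \<open>?R\<close> at most e; the added 1 keeps the denominator positive when \<open>?R\<close>
      is 0.\<close>
    have "?L \<le> (1 + e / (?R + 1)) * ?R" using e R by (intro approx) simp
    also have "\<dots> \<le> ?R + e" using e R by (simp add: field_simps)
    finally show "?L \<le> ?R + e" .
  qed
qed

subsection \<open>Joint convexity\<close>

lemma mtrace_spectral:
  assumes d: "spec_decomp n \<sigma> U l" and Y: "Y \<in> carrier_mat n n"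
  shows "mtrace (mat_adjoint Y * (\<sigma> * Y))
    = complex_of_real (\<Sum>i<n. \<Sum>j<n. l i * (cmod ((mat_adjoint U * Y * U) $$ (i,j)))\<^sup>2)"
    and "mtrace (mat_adjoint Y * (Y * \<sigma>))
    = complex_of_real (\<Sum>i<n. \<Sum>j<n. l j * (cmod ((mat_adjoint U * Y * U) $$ (i,j)))\<^sup>2)"
proof -
  have U: "unitary n U" "U \<in> carrier_mat n n" and \<sigma>: "\<sigma> = U * rdiag n l * mat_adjoint U"
    using d by (auto simp: spec_decomp_def unitary_carrier)
  have \<sigma>c: "\<sigma> \<in> carrier_mat n n" by (rule spec_decomp_carrier[OF d])
  define Z where "Z = mat_adjoint U * Y * U"
  have Z: "Z \<in> carrier_mat n n" using U Y by (auto simp: Z_def)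
  \<comment> \<open>In the eigenbasis, left multiplication by \<sigma> scales row i by l_i and right
    multiplication scales column j by l_j.\<close>
  have L: "mat_adjoint U * (\<sigma> * Y) * U = rdiag n l * Z" and R: "mat_adjoint U * (Y * \<sigma>) * U = Z * rdiag n l"
    unfolding \<sigma> Z_def using U Y unitary_adjoint_mult[OF U(1)]
    by (simp_all add: assoc_mult_mat[of _ n n _ n _ n] mult_carrier_mat[of _ n n _ n] unitary_mult_cancel[OF U(1)])
  have "mtrace (mat_adjoint Y * (\<sigma> * Y)) = mtrace (mat_adjoint Z * (rdiag n l * Z))"
    using mtrace_adjoint_mult_unitary[OF U(1) Y, of "\<sigma> * Y"] \<sigma>c Y unfolding L Z_def[symmetric] by simp
  also have "\<dots> = (\<Sum>i<n. \<Sum>j<n. cnj (Z $$ (i,j)) * (rdiag n l * Z) $$ (i,j))"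
    by (rule mtrace_adjoint_mult[OF Z]) (use Z in auto)
  also have "\<dots> = complex_of_real (\<Sum>i<n. \<Sum>j<n. l i * (cmod (Z $$ (i,j)))\<^sup>2)"
    unfolding of_real_sum of_real_mult complex_norm_square
    by (intro sum.cong refl) (simp add: rdiag_mult_index[OF Z] mult_ac del: index_mult_mat)
  finally show "mtrace (mat_adjoint Y * (\<sigma> * Y))
    = complex_of_real (\<Sum>i<n. \<Sum>j<n. l i * (cmod ((mat_adjoint U * Y * U) $$ (i,j)))\<^sup>2)"
    unfolding Z_def .
  have "mtrace (mat_adjoint Y * (Y * \<sigma>)) = mtrace (mat_adjoint Z * (Z * rdiag n l))"
    using mtrace_adjoint_mult_unitary[OF U(1) Y, of "Y * \<sigma>"] \<sigma>c Y unfolding R Z_def[symmetric] by simp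
  also have "\<dots> = (\<Sum>i<n. \<Sum>j<n. cnj (Z $$ (i,j)) * (Z * rdiag n l) $$ (i,j))"
    by (rule mtrace_adjoint_mult[OF Z]) (use Z in auto)
  also have "\<dots> = complex_of_real (\<Sum>i<n. \<Sum>j<n. l j * (cmod (Z $$ (i,j)))\<^sup>2)"
    unfolding of_real_sum of_real_mult complex_norm_square
    by (intro sum.cong refl) (simp add: rdiag_mult_index[OF Z] mult_ac del: index_mult_mat)
  finally show "mtrace (mat_adjoint Y * (Y * \<sigma>))
    = complex_of_real (\<Sum>i<n. \<Sum>j<n. l j * (cmod ((mat_adjoint U * Y * U) $$ (i,j)))\<^sup>2)"
    unfolding Z_def .
qed

text \<open>Linearity of the trace form, with the combination \<open>S\<close> given entrywise so
  that no matrix-valued sum has to be formed.\<close>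

lemma mtrace_adjoint_mult_sum:
  assumes "Y \<in> carrier_mat n n" "S \<in> carrier_mat n n" "\<And>k. k \<in> K \<Longrightarrow> T k \<in> carrier_mat n n"
    and S: "\<And>i j. i < n \<Longrightarrow> j < n \<Longrightarrow> S $$ (i,j) = (\<Sum>k\<in>K. w k * T k $$ (i,j))"
  shows "mtrace (mat_adjoint Y * S) = (\<Sum>k\<in>K. w k * mtrace (mat_adjoint Y * T k))"
proof -
  have "mtrace (mat_adjoint Y * S) = (\<Sum>i<n. \<Sum>j<n. \<Sum>k\<in>K. w k * (cnj (Y $$ (i,j)) * T k $$ (i,j)))"
    unfolding mtrace_adjoint_mult[OF assms(1,2)]
    by (intro sum.cong refl) (simp add: S sum_distrib_left mult_ac)
  also have "\<dots> = (\<Sum>k\<in>K. \<Sum>i<n. \<Sum>j<n. w k * (cnj (Y $$ (i,j)) * T k $$ (i,j)))"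
    by (rule trans[OF sum.cong[OF refl sum.swap] sum.swap])
  also have "\<dots> = (\<Sum>k\<in>K. w k * mtrace (mat_adjoint Y * T k))"
    by (intro sum.cong refl) (simp add: mtrace_adjoint_mult[OF assms(1,3)] sum_distrib_left)
  finally show ?thesis .
qed

text \<open>Jensen's inequality for the map C with components sqrt(w_k) R_k^{1/2} R_S^{-1/2}.
  Linearity of R_\<sigma> in \<sigma> makes C isometric, and linearity of L_\<sigma> gives C^* T C =
  L_S R_S^{-1}, where T is the direct sum of the L_k R_k^{-1}. At the vector R_S^{1/2} Y the two
  sides of Jensen's inequality are the forms in the conclusion.\<close>

lemma mean_form_concave:
  fixes w :: "'k \<Rightarrow> real"
  assumes f: "Fop f" and K: "finite K" and w: "\<And>k. k \<in> K \<Longrightarrow> w k \<ge> 0"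
    and dT: "\<And>k. k \<in> K \<Longrightarrow> spec_decomp n (T k) (U k) (l k)"
    and l: "\<And>k i. k \<in> K \<Longrightarrow> i < n \<Longrightarrow> l k i > 0"
    and dS: "spec_decomp n S V m" and m: "\<And>i. i < n \<Longrightarrow> m i > 0"
    and S: "\<And>i j. i < n \<Longrightarrow> j < n \<Longrightarrow> S $$ (i,j) = (\<Sum>k\<in>K. w k * T k $$ (i,j))"
    and Y: "Y \<in> carrier_mat n n"
  shows "(\<Sum>k\<in>K. w k * (\<Sum>i<n. \<Sum>j<n. l k j * f (l k i / l k j) * (cmod ((mat_adjoint (U k) * Y * U k) $$ (i,j)))\<^sup>2))
    \<le> (\<Sum>i<n. \<Sum>j<n. m j * f (m i / m j) * (cmod ((mat_adjoint V * Y * V) $$ (i,j)))\<^sup>2)"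
proof -
  have V: "unitary n V" "V \<in> carrier_mat n n" using dS by (auto simp: spec_decomp_def unitary_carrier)
  have U: "unitary n (U k)" "U k \<in> carrier_mat n n" if "k \<in> K" for k
    using dT[OF that] by (auto simp: spec_decomp_def unitary_carrier)
  have Sc: "S \<in> carrier_mat n n" by (rule spec_decomp_carrier[OF dS])
  have Tc: "T k \<in> carrier_mat n n" if "k \<in> K" for k by (rule spec_decomp_carrier[OF dT[OF that]])
  define J where "J = {..<n} \<times> {..<n}"
  define I where "I = K \<times> J"
  define Q where "Q k = mat_adjoint (U k) * V" for k
  \<comment> \<open>In coordinates: (k,i,j) labels a matrix entry in the eigenbasis of
    \<open>T k\<close>, (a,b) one in the eigenbasis of \<open>S\<close>, and \<open>Q k\<close>
    changes between the two. Right multiplication acts on the column index, so the square roots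
    carry l_kj and m_b.\<close>
  define C where "C = (\<lambda>(k,i,j) (a,b).
    complex_of_real (sqrt (w k * l k j)) * (Q k $$ (i,a) * (1 / complex_of_real (sqrt (m b))) * cnj (Q k $$ (j,b))))"
  \<comment> \<open>\<open>Zx x\<close> is R_S^{-1/2} x in the eigenbasis of \<open>S\<close>;
    \<open>Yx x\<close> is the same matrix in the standard basis, and \<open>G k x\<close> in the
    eigenbasis of \<open>T k\<close>.\<close>
  define Zx where "Zx x = mat n n (\<lambda>(a,b). x (a,b) / complex_of_real (sqrt (m b)))" for x :: "nat \<times> nat \<Rightarrow> complex"
  define Yx where "Yx x = V * Zx x * mat_adjoint V" for x
  define G where "G k x = mat_adjoint (U k) * Yx x * U k" for k x
  have Zx: "Zx x \<in> carrier_mat n n" for x by (simp add: Zx_def)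
  have Yx: "Yx x \<in> carrier_mat n n" for x using V Zx by (auto simp: Yx_def)
  have VYx: "mat_adjoint V * Yx x * V = Zx x" for x
    unfolding Yx_def using V Zx unitary_adjoint_mult[OF V(1)] right_mult_one_mat[OF Zx]
    by (simp add: assoc_mult_mat[of _ n n _ n _ n] mult_carrier_mat[of _ n n _ n] unitary_mult_cancel[OF V(1)])
  have sumJ: "sum F J = (\<Sum>i<n. \<Sum>j<n. F (i,j))" for F :: "nat \<times> nat \<Rightarrow> 'z::comm_monoid_add"
    unfolding J_def by (simp add: sum.cartesian_product)
  have sumI: "sum F I = (\<Sum>k\<in>K. \<Sum>i<n. \<Sum>j<n. F (k,i,j))" for F :: "'k \<times> nat \<times> nat \<Rightarrow> 'z::comm_monoid_add"
    unfolding I_def J_def by (simp add: sum.cartesian_product)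
  have Cx: "(\<Sum>p\<in>J. C (k,i,j) p * x p) = complex_of_real (sqrt (w k * l k j)) * G k x $$ (i,j)"
    if k: "k \<in> K" and ij: "i < n" "j < n" for k i j x
  proof -
    have Q: "Q k \<in> carrier_mat n n" using U[OF k] V by (auto simp: Q_def)
    have "G k x = Q k * Zx x * mat_adjoint (Q k)"
      unfolding G_def Q_def Yx_def using U[OF k] V Zx
      by (simp add: assoc_mult_mat[of _ n n _ n _ n] mult_carrier_mat[of _ n n _ n] mat_adjoint_mult[of _ n n _ n])
    then have "G k x $$ (i,j) = (\<Sum>b<n. (Q k * Zx x) $$ (i,b) * mat_adjoint (Q k) $$ (b,j))"
      by (simp only:) (rule mat_mult_index_sum, use Q Zx ij in auto)
    also have "\<dots> = (\<Sum>b<n. \<Sum>a<n. Q k $$ (i,a) * Zx x $$ (a,b) * cnj (Q k $$ (j,b)))"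
      using Q ij mat_mult_index_sum[OF Q Zx]
      by (intro sum.cong refl) (simp add: sum_distrib_right del: index_mult_mat)
    also have "\<dots> = (\<Sum>a<n. \<Sum>b<n. Q k $$ (i,a) * Zx x $$ (a,b) * cnj (Q k $$ (j,b)))"
      by (rule sum.swap)
    finally have G: "G k x $$ (i,j) = (\<Sum>a<n. \<Sum>b<n. Q k $$ (i,a) * Zx x $$ (a,b) * cnj (Q k $$ (j,b)))" .
    show ?thesis unfolding sumJ G sum_distrib_left
      by (intro sum.cong refl) (simp add: C_def Zx_def mult_ac)
  qed
  have Cx2: "(cmod (\<Sum>p\<in>J. C (k,i,j) p * x p))\<^sup>2 = w k * l k j * (cmod (G k x $$ (i,j)))\<^sup>2"
    if "k \<in> K" "i < n" "j < n" for k i j x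
    unfolding Cx[OF that] using w[OF that(1)] l[OF that(1,3)]
    by (simp add: norm_mult power_mult_distrib)
  \<comment> \<open>The weight \<open>c\<close> is left free: the constant 1, \<open>a\<close> and
    the values of \<open>f\<close> on \<open>a\<close> give the isometry, the hypothesis of Jensen's
    inequality and its conclusion. \<open>Zx_form\<close> is used likewise with
    \<open>b\<close>.\<close>
  have C_form: "(\<Sum>q\<in>I. c q * (cmod (\<Sum>p\<in>J. C q p * x p))\<^sup>2)
      = (\<Sum>k\<in>K. w k * (\<Sum>i<n. \<Sum>j<n. l k j * c (k,i,j) * (cmod (G k x $$ (i,j)))\<^sup>2))" for c x
    unfolding sumI sum_distrib_left by (intro sum.cong refl) (simp add: Cx2)
  have m_nz: "m j \<noteq> 0" if "j < n" for j using m[OF that] by simp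
  have Zx_form: "(\<Sum>i<n. \<Sum>j<n. m j * c (i,j) * (cmod (Zx x $$ (i,j)))\<^sup>2) = (\<Sum>p\<in>J. c p * (cmod (x p))\<^sup>2)" for c x
    unfolding sumJ using m m_nz
    by (intro sum.cong refl) (simp add: Zx_def norm_divide power_divide less_imp_le)
  \<comment> \<open>Both sides are the trace of Y^* Y S with Y = \<open>Yx x\<close>: once expanded
    over the sum for \<open>S\<close> and evaluated in the eigenbasis of each \<open>T k\<close>,
    once evaluated in that of \<open>S\<close>. \<open>left\<close> does the same for Y^* S
    Y.\<close>
  have right: "(\<Sum>k\<in>K. w k * (\<Sum>i<n. \<Sum>j<n. l k j * (cmod (G k x $$ (i,j)))\<^sup>2))
      = (\<Sum>i<n. \<Sum>j<n. m j * (cmod (Zx x $$ (i,j)))\<^sup>2)" for x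
  proof -
    have "mtrace (mat_adjoint (Yx x) * (Yx x * S)) = (\<Sum>k\<in>K. w k * mtrace (mat_adjoint (Yx x) * (Yx x * T k)))"
    proof (rule mtrace_adjoint_mult_sum[OF Yx])
      fix i j assume ij: "i < n" "j < n"
      show "(Yx x * S) $$ (i,j) = (\<Sum>k\<in>K. complex_of_real (w k) * (Yx x * T k) $$ (i,j))"
        unfolding mat_mult_index_sum[OF Yx Sc ij]
        using ij mat_mult_index_sum[OF Yx Tc ij]
        by (simp add: S sum_distrib_left sum.swap[of _ K] mult_ac del: index_mult_mat)
    qed (use Yx[of x] Sc Tc in \<open>auto intro!: mult_carrier_mat[of _ n n]\<close>)
    also have "\<dots> = complex_of_real (\<Sum>k\<in>K. w k * (\<Sum>i<n. \<Sum>j<n. l k j * (cmod (G k x $$ (i,j)))\<^sup>2))"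
      unfolding of_real_sum[of _ K] of_real_mult[of "w _"] G_def
      by (intro sum.cong refl) (simp only: mtrace_spectral(2)[OF dT Yx])
    finally show ?thesis
      unfolding mtrace_spectral(2)[OF dS Yx] VYx of_real_eq_iff by simp
  qed
  have left: "(\<Sum>k\<in>K. w k * (\<Sum>i<n. \<Sum>j<n. l k i * (cmod (G k x $$ (i,j)))\<^sup>2))
      = (\<Sum>i<n. \<Sum>j<n. m i * (cmod (Zx x $$ (i,j)))\<^sup>2)" for x
  proof -
    have "mtrace (mat_adjoint (Yx x) * (S * Yx x)) = (\<Sum>k\<in>K. w k * mtrace (mat_adjoint (Yx x) * (T k * Yx x)))"
    proof (rule mtrace_adjoint_mult_sum[OF Yx])
      fix i j assume ij: "i < n" "j < n"
      show "(S * Yx x) $$ (i,j) = (\<Sum>k\<in>K. complex_of_real (w k) * (T k * Yx x) $$ (i,j))"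
        unfolding mat_mult_index_sum[OF Sc Yx ij]
        using ij mat_mult_index_sum[OF Tc Yx ij]
        by (simp add: S sum_distrib_left sum_distrib_right sum.swap[of _ K] mult_ac del: index_mult_mat)
    qed (use Yx[of x] Sc Tc in \<open>auto intro!: mult_carrier_mat[of _ n n]\<close>)
    also have "\<dots> = complex_of_real (\<Sum>k\<in>K. w k * (\<Sum>i<n. \<Sum>j<n. l k i * (cmod (G k x $$ (i,j)))\<^sup>2))"
      unfolding of_real_sum[of _ K] of_real_mult[of "w _"] G_def
      by (intro sum.cong refl) (simp only: mtrace_spectral(1)[OF dT Yx])
    finally show ?thesis
      unfolding mtrace_spectral(1)[OF dS Yx] VYx of_real_eq_iff by simp
  qed
  define a where "a = (\<lambda>(k,i,j). l k i / l k j)"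
  define b where "b = (\<lambda>(i,j). m i / m j)"
  have iso: "(\<Sum>q\<in>I. (cmod (\<Sum>p\<in>J. C q p * x p))\<^sup>2) = (\<Sum>p\<in>J. (cmod (x p))\<^sup>2)" for x
    using C_form[of "\<lambda>_. 1" x] Zx_form[of "\<lambda>_. 1" x] right[of x] by simp
  \<comment> \<open>Multiplied by the column weight l_kj, the ratio l_ki / l_kj becomes the row
    weight l_ki, so \<open>left\<close> applies.\<close>
  have aform: "(\<Sum>q\<in>I. a q * (cmod (\<Sum>p\<in>J. C q p * x p))\<^sup>2) = (\<Sum>p\<in>J. b p * (cmod (x p))\<^sup>2)" for x
  proof -
    have "(\<Sum>q\<in>I. a q * (cmod (\<Sum>p\<in>J. C q p * x p))\<^sup>2)
        = (\<Sum>k\<in>K. w k * (\<Sum>i<n. \<Sum>j<n. l k i * (cmod (G k x $$ (i,j)))\<^sup>2))"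
      unfolding C_form using l
      by (intro sum.cong refl arg_cong2[where f = "(*)"]) (auto simp: a_def less_imp_neq[symmetric])
    also have "\<dots> = (\<Sum>i<n. \<Sum>j<n. m j * b (i,j) * (cmod (Zx x $$ (i,j)))\<^sup>2)"
      unfolding left using m
      by (intro sum.cong refl arg_cong2[where f = "(*)"]) (auto simp: b_def less_imp_neq[symmetric])
    finally show ?thesis unfolding Zx_form .
  qed
  \<comment> \<open>The coordinates of R_S^{1/2} Y, chosen so that \<open>Yx x\<close> gives back
    \<open>Y\<close>.\<close>
  define x where "x = (\<lambda>(i,j). complex_of_real (sqrt (m j)) * (mat_adjoint V * Y * V) $$ (i,j))"
  have Zx_eq: "Zx x = mat_adjoint V * Y * V"
  proof (rule eq_matI)
    fix i j assume "i < dim_row (mat_adjoint V * Y * V)" "j < dim_col (mat_adjoint V * Y * V)"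
    then have "i < n" "j < n" using V by auto
    then show "Zx x $$ (i,j) = (mat_adjoint V * Y * V) $$ (i,j)"
      using m[of j] by (simp add: Zx_def x_def del: index_mult_mat)
  qed (use V in \<open>auto simp: Zx_def\<close>)
  have "Yx x = Y"
    unfolding Yx_def Zx_eq using V Y unitary_mult_adjoint[OF V(1)]
    by (simp add: assoc_mult_mat[of _ n n _ n _ n] mult_carrier_mat[of _ n n _ n] unitary_mult_cancel[OF V(1)])
  then have G_eq: "G k x = mat_adjoint (U k) * Y * U k" for k by (simp add: G_def)
  have "(\<Sum>q\<in>I. f (a q) * (cmod (\<Sum>p\<in>J. C q p * x p))\<^sup>2) \<le> (\<Sum>p\<in>J. f (b p) * (cmod (x p))\<^sup>2)"
  proof (rule isometric_Jensen[OF f _ _ iso])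
    show "finite I" "finite J" using K by (auto simp: I_def J_def)
    show "a q > 0" if "q \<in> I" for q using that l by (auto simp: I_def J_def a_def)
    show "b p > 0" if "p \<in> J" for p using that m by (auto simp: J_def b_def)
  qed (simp add: aform)
  then show ?thesis
    unfolding C_form Zx_form[of "\<lambda>p. f (b p)", symmetric] G_eq Zx_eq by (simp add: a_def b_def)
qed

section \<open>Duality and joint convexity of the metric\<close>

lemma Legendre_quadratic_bound:
  assumes "c > 0"
  shows "2 * Re (cnj u * v) - c * (cmod v)\<^sup>2 \<le> 1 / c * (cmod u)\<^sup>2"
proof -
  \<comment> \<open>The square vanishes at v = u / c, where the bound is an equality; this is the
    maximiser in the variational formula.\<close>
  have "0 \<le> (cmod (u + complex_of_real (- c) * v))\<^sup>2" by simp
  also have "\<dots> = (cmod u)\<^sup>2 + c\<^sup>2 * (cmod v)\<^sup>2 - 2 * c * Re (cnj u * v)"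
    unfolding cmod_add_squared by (simp add: norm_mult power_mult_distrib algebra_simps)
  finally have "2 * c * Re (cnj u * v) - c\<^sup>2 * (cmod v)\<^sup>2 \<le> (cmod u)\<^sup>2" by simp
  then show ?thesis using assms by (simp add: field_simps power2_eq_square)
qed

text \<open>A single trial matrix serves in all the suprema: Y = M(S)^{-1} D attains the supremum
  for the averaged pair and is merely a competitor for each pair of \<open>T k\<close> and
  \<open>X k\<close>. Concavity of <Y, M(\<sigma>) Y> compares the subtracted terms.\<close>

lemma Kmetric_jointly_convex:
  fixes w :: "'k \<Rightarrow> real"
  assumes f: "Fop f" and K: "finite K" and w: "\<And>k. k \<in> K \<Longrightarrow> w k \<ge> 0"
    and T: "\<And>k. k \<in> K \<Longrightarrow> pd n (T k)" and X: "\<And>k. k \<in> K \<Longrightarrow> X k \<in> carrier_mat n n"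
    and S: "pd n S" and D: "D \<in> carrier_mat n n"
    and S_eq: "\<And>i j. i < n \<Longrightarrow> j < n \<Longrightarrow> S $$ (i,j) = (\<Sum>k\<in>K. w k * T k $$ (i,j))"
    and D_eq: "\<And>i j. i < n \<Longrightarrow> j < n \<Longrightarrow> D $$ (i,j) = (\<Sum>k\<in>K. w k * X k $$ (i,j))"
  shows "Re (Kmetric f S D D) \<le> (\<Sum>k\<in>K. w k * Re (Kmetric f (T k) (X k) (X k)))"
proof -
  have "\<exists>U l. spec_decomp n (T k) U l" if "k \<in> K" for k
    using T[OF that] by (intro hermitian_spec_decomp) (simp add: pd_def)
  then obtain U l where dT: "\<And>k. k \<in> K \<Longrightarrow> spec_decomp n (T k) (U k) (l k)" by metis
  obtain V m where dS: "spec_decomp n S V m"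
    using S hermitian_spec_decomp unfolding pd_def by blast
  have l: "l k i > 0" if "k \<in> K" "i < n" for k i using T pd_spectral[OF dT] that by blast
  have m: "m i > 0" if "i < n" for i using S pd_spectral[OF dS] that by blast
  have fpos: "f t > 0" if "t > 0" for t using f that unfolding Fop_def by blast
  have V: "unitary n V" "V \<in> carrier_mat n n" using dS by (auto simp: spec_decomp_def unitary_carrier)
  have U: "unitary n (U k)" "U k \<in> carrier_mat n n" if "k \<in> K" for k
    using dT[OF that] by (auto simp: spec_decomp_def unitary_carrier)
  define M where "M l i j = l j * f (l i / l j)" for l :: "nat \<Rightarrow> real" and i j
  have MC_M: "MC f (l i) (l j) = 1 / M l i j" for l i j by (simp add: MC_def M_def)
  have M_pos: "M m i j > 0" if "i < n" "j < n" for i j using that m fpos by (simp add: M_def)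
  have M_pos': "M (l k) i j > 0" if "k \<in> K" "i < n" "j < n" for k i j
    using that l fpos by (simp add: M_def)
  define Z where "Z = mat_adjoint V * D * V"
  \<comment> \<open>\<open>F\<close> is M(S)^{-1} D in the eigenbasis of \<open>S\<close>, where the
    inverse is division of entries.\<close>
  define F where "F = mat n n (\<lambda>(i,j). Z $$ (i,j) / complex_of_real (M m i j))"
  define Y where "Y = V * F * mat_adjoint V"
  have Z: "Z \<in> carrier_mat n n" and F: "F \<in> carrier_mat n n" using V D by (auto simp: Z_def F_def)
  have Y: "Y \<in> carrier_mat n n" using V F by (auto simp: Y_def)
  have VY: "mat_adjoint V * Y * V = F"
    unfolding Y_def using V F unitary_adjoint_mult[OF V(1)]
    by (simp add: assoc_mult_mat[of _ n n _ n _ n] mult_carrier_mat[of _ n n _ n] unitary_mult_cancel[OF V(1)])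
  \<comment> \<open>At the maximiser both <D, Y> and <Y, M(S) Y> equal \<chi>; see \<open>DY\<close>
    and \<open>MF\<close>.\<close>
  define \<chi> where "\<chi> = (\<Sum>i<n. \<Sum>j<n. 1 / M m i j * (cmod (Z $$ (i,j)))\<^sup>2)"
  have \<chi>: "Re (Kmetric f S D D) = \<chi>"
    unfolding Kmetric_spec_decomp[OF dS D] MC_M \<chi>_def Z_def by simp
  have MF: "(\<Sum>i<n. \<Sum>j<n. M m i j * (cmod (F $$ (i,j)))\<^sup>2) = \<chi>"
    unfolding \<chi>_def
    by (intro sum.cong refl) (use M_pos in \<open>simp add: F_def norm_divide power_divide power2_eq_square field_simps\<close>)
  have DY: "Re (mtrace (mat_adjoint D * Y)) = \<chi>"
  proof -
    have "mtrace (mat_adjoint D * Y) = mtrace (mat_adjoint Z * F)"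
      using mtrace_adjoint_mult_unitary[OF V(1) D Y] unfolding VY Z_def by simp
    also have "\<dots> = (\<Sum>i<n. \<Sum>j<n. cnj (Z $$ (i,j)) * F $$ (i,j))"
      by (rule mtrace_adjoint_mult[OF Z F])
    also have "\<dots> = complex_of_real \<chi>"
      unfolding \<chi>_def of_real_sum of_real_mult complex_norm_square
      by (intro sum.cong refl) (simp add: F_def)
    finally show ?thesis by simp
  qed
  have DY_sum: "Re (mtrace (mat_adjoint D * Y)) = (\<Sum>k\<in>K. w k * Re (mtrace (mat_adjoint (X k) * Y)))"
  proof -
    have adj: "Re (mtrace (mat_adjoint A * Y)) = Re (mtrace (mat_adjoint Y * A))" if "A \<in> carrier_mat n n" for A
      unfolding mtrace_adjoint_mult[OF that Y] mtrace_adjoint_mult[OF Y that] Re_sum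
      by (intro sum.cong refl) simp
    have "mtrace (mat_adjoint Y * D) = (\<Sum>k\<in>K. w k * mtrace (mat_adjoint Y * X k))"
      by (rule mtrace_adjoint_mult_sum[OF Y D X D_eq])
    then show ?thesis by (simp add: adj[OF D] adj[OF X])
  qed
  have bound: "2 * Re (mtrace (mat_adjoint (X k) * Y))
      - (\<Sum>i<n. \<Sum>j<n. M (l k) i j * (cmod ((mat_adjoint (U k) * Y * U k) $$ (i,j)))\<^sup>2)
      \<le> Re (Kmetric f (T k) (X k) (X k))" if k: "k \<in> K" for k
  proof -
    define A where "A = mat_adjoint (U k) * X k * U k"
    define B where "B = mat_adjoint (U k) * Y * U k"
    have A: "A \<in> carrier_mat n n" and B: "B \<in> carrier_mat n n"
      using U[OF k] X[OF k] Y by (auto simp: A_def B_def)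
    have "mtrace (mat_adjoint (X k) * Y) = (\<Sum>i<n. \<Sum>j<n. cnj (A $$ (i,j)) * B $$ (i,j))"
      using mtrace_adjoint_mult_unitary[OF U(1)[OF k] X[OF k] Y]
      unfolding A_def[symmetric] B_def[symmetric] mtrace_adjoint_mult[OF A B] ..
    then have "2 * Re (mtrace (mat_adjoint (X k) * Y)) - (\<Sum>i<n. \<Sum>j<n. M (l k) i j * (cmod (B $$ (i,j)))\<^sup>2)
        = (\<Sum>i<n. \<Sum>j<n. 2 * Re (cnj (A $$ (i,j)) * B $$ (i,j)) - M (l k) i j * (cmod (B $$ (i,j)))\<^sup>2)"
      by (simp only: Re_sum sum_distrib_left sum_subtractf)
    also have "\<dots> \<le> (\<Sum>i<n. \<Sum>j<n. 1 / M (l k) i j * (cmod (A $$ (i,j)))\<^sup>2)"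
      by (intro sum_mono Legendre_quadratic_bound M_pos'[OF k]) auto
    also have "\<dots> = Re (Kmetric f (T k) (X k) (X k))"
      unfolding Kmetric_spec_decomp[OF dT[OF k] X[OF k]] MC_M A_def by simp
    finally show ?thesis unfolding B_def .
  qed
  have "(\<Sum>k\<in>K. w k * (\<Sum>i<n. \<Sum>j<n. M (l k) i j * (cmod ((mat_adjoint (U k) * Y * U k) $$ (i,j)))\<^sup>2)) \<le> \<chi>"
    using mean_form_concave[OF f K w dT l dS m S_eq Y] unfolding VY MF[symmetric] M_def by blast
  \<comment> \<open>The weighted sum of the terms 2 Re <X_k, Y> is 2 \<chi> and that of the
    subtracted forms is at most \<chi>, which leaves at least \<chi>.\<close>
  then have "\<chi> \<le> (\<Sum>k\<in>K. w k * (2 * Re (mtrace (mat_adjoint (X k) * Y))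
      - (\<Sum>i<n. \<Sum>j<n. M (l k) i j * (cmod ((mat_adjoint (U k) * Y * U k) $$ (i,j)))\<^sup>2)))"
    using DY DY_sum by (simp only: right_diff_distrib sum_subtractf mult.left_commute[of _ 2] sum_distrib_left[symmetric])
  also have "\<dots> \<le> (\<Sum>k\<in>K. w k * Re (Kmetric f (T k) (X k) (X k)))"
    by (intro sum_mono mult_left_mono bound w)
  finally show ?thesis unfolding \<chi> .
qed

theorem mainTheorem1:
  fixes f :: "real \<Rightarrow> real" and n :: nat
    and \<rho>1 \<rho>2 \<sigma>1 \<sigma>2 :: "complex mat" and lam :: real
  assumes "Fop f" and "n \<ge> 1"
    and "density n \<rho>1" and "pd n \<rho>1"
    and "density n \<rho>2" and "pd n \<rho>2"
    and "density n \<sigma>1" and "pd n \<sigma>1"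
    and "density n \<sigma>2" and "pd n \<sigma>2"
    and "0 \<le> lam" and "lam \<le> 1"
  shows "Re (chi2 f (complex_of_real lam \<cdot>\<^sub>m \<rho>1 + complex_of_real (1 - lam) \<cdot>\<^sub>m \<rho>2)
                   (complex_of_real lam \<cdot>\<^sub>m \<sigma>1 + complex_of_real (1 - lam) \<cdot>\<^sub>m \<sigma>2))
         \<le> lam * Re (chi2 f \<rho>1 \<sigma>1) + (1 - lam) * Re (chi2 f \<rho>2 \<sigma>2)"
proof -
  have c: "\<rho>1 \<in> carrier_mat n n" "\<rho>2 \<in> carrier_mat n n" "\<sigma>1 \<in> carrier_mat n n" "\<sigma>2 \<in> carrier_mat n n"
    using assms by (auto simp: pd_def hermitian_def)
  define S where "S = complex_of_real lam \<cdot>\<^sub>m \<sigma>1 + complex_of_real (1 - lam) \<cdot>\<^sub>m \<sigma>2"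
  define R where "R = complex_of_real lam \<cdot>\<^sub>m \<rho>1 + complex_of_real (1 - lam) \<cdot>\<^sub>m \<rho>2"
  have SR: "S \<in> carrier_mat n n" "R \<in> carrier_mat n n" using c by (auto simp: S_def R_def)
  have h: "hermitian n \<sigma>1" "hermitian n \<sigma>2" using assms by (auto simp: pd_def)
  have "mat_adjoint S = S"
    using c SR hermitian_index[OF h(1)] hermitian_index[OF h(2)]
    by (intro eq_matI) (auto simp: S_def)
  then have hS: "hermitian n S" using SR by (simp add: hermitian_def)
  have pdS: "pd n S"
    unfolding pd_def
  proof (intro conjI hS ballI impI)
    fix v :: "complex vec" assume v: "v \<in> carrier_vec n" "v \<noteq> 0\<^sub>v n"
    have "qform n S v = complex_of_real lam * qform n \<sigma>1 v + complex_of_real (1 - lam) * qform n \<sigma>2 v"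
      unfolding qform_def sum_distrib_left sum.distrib[symmetric]
      by (intro sum.cong refl) (use c in \<open>simp add: S_def algebra_simps\<close>)
    then have q: "Re (qform n S v) = lam * Re (qform n \<sigma>1 v) + (1 - lam) * Re (qform n \<sigma>2 v)" by simp
    have p: "Re (qform n \<sigma>1 v) > 0" "Re (qform n \<sigma>2 v) > 0" using assms v by (auto simp: pd_def)
    show "0 < Re (qform n S v)"
    \<comment> \<open>At \<open>lam = 0\<close> strict positivity comes from the second term;
      otherwise the first is positive and the second nonnegative.\<close>
    proof (cases "lam = 0")
      case False
      then show ?thesis unfolding q using assms p by (intro add_pos_nonneg) auto
    qed (use q p in simp)
  qed
  \<comment> \<open>A two-point mixture is a family indexed by \<open>bool\<close>, and
    \<open>R - S\<close> is the mixture of the two differences.\<close>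
  let ?w = "\<lambda>k::bool. if k then lam else 1 - lam"
  let ?T = "\<lambda>k::bool. if k then \<sigma>1 else \<sigma>2"
  let ?X = "\<lambda>k::bool. if k then \<rho>1 - \<sigma>1 else \<rho>2 - \<sigma>2"
  have "Re (Kmetric f S (R - S) (R - S)) \<le> (\<Sum>k\<in>UNIV. ?w k * Re (Kmetric f (?T k) (?X k) (?X k)))"
    by (rule Kmetric_jointly_convex[OF assms(1), where n = n])
      (use assms c SR pdS in \<open>auto simp: UNIV_bool S_def R_def algebra_simps\<close>)
  then show ?thesis unfolding chi2_def S_def[symmetric] R_def[symmetric] by (simp add: UNIV_bool)
qed

end
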